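(* Let $N$ be an ordered negative support family for $\mathbf v_0$. Assume that $$\bigl(\langle A\mathbf t\rangle\widehat M_N+\widehat P_N\bigr):\widehat m_N(\mathbf t)=\bigl(\langle A\mathbf t\rangle\cap\widehat M_N+\widehat P_N\bigr):\widehat m_N(\mathbf t)$$ as ideals of $\mathbb C[[\mathbf t]]$. Then $$\Phi(\widehat Q_N:\widehat m_N(\mathbf t))=P_N:m_N(\mathbf s).$$
   Context: $\mathbb N$ is the set of nonnegative integers. Let $A=(\mathbf a_1,\dots,\mathbf a_n)=(a_{ij})$ be a $d\times n$ integer matrix of rank $d$ whose columns all lie in a single affine hyperplane of $\mathbb Q^d$ not passing through the origin. Put $L=\operatorname{Ker}_{\mathbb Z}(A)\subset\mathbb Z^n$ and $L_{\mathbb C}=\operatorname{Ker}_{\mathbb C}(A)$. The toric ideal is $I_A=\langle\partial_{\mathbf x}^{\mathbf u}-\partial_{\mathbf x}^{\mathbf v}\mid A\mathbf u=A\mathbf v,\ \mathbf u,\mathbf v\in\mathbb N^n\rangle\subset\mathbb C[\partial_1,\dots,\partial_n]$. For $\boldsymbol\beta\in\mathbb C^d$, $H_A(\boldsymbol\beta)$ is the left ideal of the Weyl algebra $D$ in $x_j,\partial_j$ generated by $I_A$ and the operators $\sum_j a_{ij}\theta_j-\beta_i$ ($1\le i\le d$), $\theta_j=x_j\partial_j$. Fix a generic weight $\mathbf w\in\mathbb R^n$, i.e. such that $\operatorname{in}_{\mathbf w}(I_A)$ (generated by the parts of maximal $\mathbf w$-weight of elements of $I_A$) is a monomial ideal,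 and a fake exponent $\mathbf v_0\in\mathbb C^n$ of $H_A(\boldsymbol\beta)$ with respect to $\mathbf w$, i.e. a zero of $(D\operatorname{in}_{\mathbf w}(I_A)\cap\mathbb C[\boldsymbol\theta])+\langle A\boldsymbol\theta-\boldsymbol\beta\rangle\subset\mathbb C[\boldsymbol\theta]$. For $\mathbf u\in L$ put $I_{\mathbf u}=\{j\mid(\mathbf v_0+\mathbf u)_j\in\mathbb Z_{<0}\}$; put $\mathrm{NS}=\{I_{\mathbf u}\mid\mathbf u\in L\}$ and $\mathcal N_{\mathbf v_0}=\{I\in\mathrm{NS}\mid \mathbf w\cdot\mathbf u\ge0\text{ for every }\mathbf u\in L\text{ with }I_{\mathbf u}=I\}$. A negative support family for $\mathbf v_0$ is a set $N$ with $I_{\mathbf 0}\in N\subset\mathcal N_{\mathbf v_0}$; it is ordered if $I\in N$, $J\in\mathrm{NS}$, $J\subset I$ imply $J\in N$. Put $N^c=\mathrm{NS}\setminus N$ and $K_N=\bigcap_{I\in N}I$. Ambient side: $\mathbf t=(t_1,\dots,t_n)$, $\mathbf t^S=\prod_{j\in S}t_j$ (empty product $=1$). In $\mathbb C[[\mathbf t]]$ put $\widehat m_N(\mathbf t)=\mathbf t^{I_{\mathbf 0}\setminus K_N}$, $\widehat M_N=\langle\mathbf t^{I\setminus K_N}\mid I\in N\rangle$, $\widehat P_N=\langle\mathbf t^{(I\cup J)\setminus K_N}\mid I\in N,J\in N^c\rangle$, $\langle A\mathbf t\rangle=\langle\sum_j a_{ij}t_j\mid1\le i\le d\rangle$, $\widehat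 Q_N=\langle A\mathbf t\rangle\widehat M_N+\widehat P_N$. The expression $\langle A\mathbf t\rangle\cap\widehat M_N+\widehat P_N$ means $(\langle A\mathbf t\rangle\cap\widehat M_N)+\widehat P_N$. Intrinsic side: fix a basis $\mathbf b^{(1)},\dots,\mathbf b^{(n-d)}$ of $L_{\mathbb C}$, also viewed as the matrix $B$ with these columns; $\mathbf s=(s_1,\dots,s_{n-d})$, $(B\mathbf s)_j=\sum_k b^{(k)}_j s_k$, $(B\mathbf s)^S=\prod_{j\in S}(B\mathbf s)_j$. In $\mathbb C[[\mathbf s]]$ put $m_N(\mathbf s)=(B\mathbf s)^{I_{\mathbf 0}\setminus K_N}$ and $P_N=\langle(B\mathbf s)^{(I\cup J)\setminus K_N}\mid I\in N,J\in N^c\rangle$. $\Phi:\mathbb C[[\mathbf t]]\to\mathbb C[[\mathbf s]]$ is the $\mathbb C$-algebra homomorphism $f\mapsto f((B\mathbf s)_1,\dots,(B\mathbf s)_n)$. $J:m=\{f\mid fm\in J\}$ (formed in the respective power series ring). *)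

theory Defs
  imports
    "HOL-Analysis.Analysis"
    "HOL-Library.Poly_Mapping"
    "HOL-Algebra.Ideal_Product"
    "HOL-Algebra.Algebraic_Closure_Type"
begin

section \<open>Multivariate formal power series\<close>

text \<open>
  A series in variables indexed by \<open>'v\<close> is the family of its coefficients, indexed by
  the exponents \<open>'v \<Rightarrow>\<^sub>0 nat\<close>.
\<close>

typedef ('v, 'a) mps = "UNIV :: (('v \<Rightarrow>\<^sub>0 nat) \<Rightarrow> 'a) set"
  morphisms mps_coeff Abs_mps
  by simp

lemma mps_coeff_Abs [simp]: "mps_coeff (Abs_mps f) = f"
  by (simp add: Abs_mps_inverse)

lemma mps_eqI: "(\<And>\<gamma>. mps_coeff f \<gamma> = mps_coeff g \<gamma>) \<Longrightarrow> f = g"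
  by (metis ext mps_coeff_inject)

lemma finite_exponents_below:
  fixes \<gamma> :: "'v \<Rightarrow>\<^sub>0 nat"
  shows "finite {\<alpha>. \<exists>\<beta>. \<alpha> + \<beta> = \<gamma>}"
proof -
  let ?S = "{\<alpha>. \<exists>\<beta>. \<alpha> + \<beta> = \<gamma>}"
  let ?F = "{h. \<forall>x. (x \<in> Poly_Mapping.keys \<gamma> \<longrightarrow>
                   h x \<in> {..Max (insert 0 (Poly_Mapping.lookup \<gamma> ` Poly_Mapping.keys \<gamma>))}) \<and>
               (x \<notin> Poly_Mapping.keys \<gamma> \<longrightarrow> h x = (0::nat))}"
  have fin: "finite ?F"
    by (rule finite_set_of_finite_funs) simp_all
  have "Poly_Mapping.lookup ` ?S \<subseteq> ?F"
  proof (rule image_subsetI)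
    fix \<alpha> assume "\<alpha> \<in> ?S"
    then obtain \<beta> where g: "\<alpha> + \<beta> = \<gamma>" by blast
    have le: "Poly_Mapping.lookup \<alpha> x \<le> Poly_Mapping.lookup \<gamma> x" for x
      by (simp add: g [symmetric] Poly_Mapping.lookup_add)
    show "Poly_Mapping.lookup \<alpha> \<in> ?F"
    proof (intro CollectI conjI allI impI)
      fix x assume "x \<in> Poly_Mapping.keys \<gamma>"
      then have "Poly_Mapping.lookup \<gamma> x \<le> Max (insert 0 (Poly_Mapping.lookup \<gamma> ` Poly_Mapping.keys \<gamma>))"
        by (intro Max_ge) auto
      with le [of x] show "Poly_Mapping.lookup \<alpha> x \<in> {..Max (insert 0 (Poly_Mapping.lookup \<gamma> ` Poly_Mapping.keys \<gamma>))}"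
        by simp
    next
      fix x assume "x \<notin> Poly_Mapping.keys \<gamma>"
      with le [of x] show "Poly_Mapping.lookup \<alpha> x = 0" by (simp add: in_keys_iff)
    qed
  qed
  then have "finite (Poly_Mapping.lookup ` ?S)" using fin by (rule finite_subset)
  moreover have "inj_on Poly_Mapping.lookup ?S" by (simp add: inj_on_def Poly_Mapping.lookup_inject)
  ultimately show ?thesis by (rule finite_imageD)
qed

lemma finite_exponent_pairs [simp]:
  fixes \<gamma> :: "'v \<Rightarrow>\<^sub>0 nat"
  shows "finite {(\<alpha>, \<beta>). \<alpha> + \<beta> = \<gamma>}"
proof (rule finite_subset)
  let ?S = "{\<alpha>. \<exists>\<beta>. \<alpha> + \<beta> = \<gamma>}"
  show "{(\<alpha>, \<beta>). \<alpha> + \<beta> = \<gamma>} \<subseteq> ?S \<times> ?S"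
    by clarsimp (metis add.commute)
  show "finite (?S \<times> ?S)"
    using finite_exponents_below by blast
qed

instantiation mps :: (type, comm_ring_1) comm_ring_1
begin

definition "0 = Abs_mps (\<lambda>_. 0)"
definition "1 = Abs_mps (\<lambda>\<gamma>. if \<gamma> = 0 then 1 else 0)"
definition "f + g = Abs_mps (\<lambda>\<gamma>. mps_coeff f \<gamma> + mps_coeff g \<gamma>)"
definition "- f = Abs_mps (\<lambda>\<gamma>. - mps_coeff f \<gamma>)"
definition "f - g = Abs_mps (\<lambda>\<gamma>. mps_coeff f \<gamma> - mps_coeff g \<gamma>)"
definition "f * g =
  Abs_mps (\<lambda>\<gamma>. \<Sum>(\<alpha>, \<beta>) \<in> {(\<alpha>, \<beta>). \<alpha> + \<beta> = \<gamma>}. mps_coeff f \<alpha> * mps_coeff g \<beta>)"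

instance
proof
  fix f g h :: "('a, 'b) mps"
  show "f * g * h = f * (g * h)"
  proof (rule mps_eqI)
    fix \<gamma>
    let ?P = "\<lambda>\<gamma>::'a \<Rightarrow>\<^sub>0 nat. {(\<alpha>, \<beta>). \<alpha> + \<beta> = \<gamma>}"
    have "mps_coeff (f * g * h) \<gamma> =
        (\<Sum>p\<in>?P \<gamma>. \<Sum>q\<in>?P (fst p). mps_coeff f (fst q) * mps_coeff g (snd q) * mps_coeff h (snd p))"
      by (simp add: times_mps_def case_prod_unfold sum_distrib_right)
    also have "\<dots> = (\<Sum>(p, q)\<in>Sigma (?P \<gamma>) (\<lambda>p. ?P (fst p)).
        mps_coeff f (fst q) * mps_coeff g (snd q) * mps_coeff h (snd p))"
      by (rule sum.Sigma) (auto intro: finite_exponent_pairs)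
    also have "\<dots> = (\<Sum>(p, q)\<in>Sigma (?P \<gamma>) (\<lambda>p. ?P (snd p)).
        mps_coeff f (fst p) * (mps_coeff g (fst q) * mps_coeff h (snd q)))"
      by (rule sum.reindex_bij_witness
          [where i = "\<lambda>((a, b), (c, e)). ((a + c, e), (a, c))"
             and j = "\<lambda>((a, b), (c, e)). ((c, e + b), (e, b))"])
         (auto simp: algebra_simps)
    also have "\<dots> =
        (\<Sum>p\<in>?P \<gamma>. \<Sum>q\<in>?P (snd p). mps_coeff f (fst p) * (mps_coeff g (fst q) * mps_coeff h (snd q)))"
      by (rule sum.Sigma [symmetric]) (auto intro: finite_exponent_pairs)
    also have "\<dots> = mps_coeff (f * (g * h)) \<gamma>"
      by (simp add: times_mps_def case_prod_unfold sum_distrib_left)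
    finally show "mps_coeff (f * g * h) \<gamma> = mps_coeff (f * (g * h)) \<gamma>" .
  qed
  show "f * g = g * f"
  proof (rule mps_eqI)
    fix \<gamma>
    show "mps_coeff (f * g) \<gamma> = mps_coeff (g * f) \<gamma>"
      unfolding times_mps_def mps_coeff_Abs
      by (rule sum.reindex_bij_witness [where i = prod.swap and j = prod.swap])
         (auto simp: algebra_simps)
  qed
  show "1 * f = f"
  proof (rule mps_eqI)
    fix \<gamma>
    have "mps_coeff (1 * f) \<gamma> =
        (\<Sum>p\<in>{(\<alpha>, \<beta>). \<alpha> + \<beta> = \<gamma>}. if p = (0, \<gamma>) then mps_coeff f \<gamma> else 0)"
      unfolding times_mps_def one_mps_def mps_coeff_Abs
      by (rule sum.cong) (auto split: if_splits)
    also have "\<dots> = mps_coeff f \<gamma>" by (subst sum.delta) auto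
    finally show "mps_coeff (1 * f) \<gamma> = mps_coeff f \<gamma>" .
  qed
  show "(f + g) * h = f * h + g * h"
    by (rule mps_eqI)
       (simp add: times_mps_def plus_mps_def case_prod_unfold distrib_right sum.distrib)
  show "(0::('a, 'b) mps) \<noteq> 1"
  proof
    assume "(0::('a, 'b) mps) = 1"
    then have "mps_coeff (0::('a, 'b) mps) 0 = mps_coeff 1 0" by simp
    then show False by (simp add: zero_mps_def one_mps_def)
  qed
qed (auto intro!: mps_eqI simp: plus_mps_def zero_mps_def uminus_mps_def minus_mps_def algebra_simps)

end

definition mps_const :: "'a::comm_ring_1 \<Rightarrow> ('v, 'a) mps" where
  "mps_const c = Abs_mps (\<lambda>\<gamma>. if \<gamma> = 0 then c else 0)"

definition mps_var :: "'v \<Rightarrow> ('v, 'a::comm_ring_1) mps" where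
  "mps_var j = Abs_mps (\<lambda>\<gamma>. if \<gamma> = Poly_Mapping.single j 1 then 1 else 0)"

text \<open>
  The ring of power series in the variables from \<open>V\<close> only. The set \<open>V\<close> may be empty, which is
  needed for the parameters \<open>s\<close> when \<open>n = d\<close>.
\<close>

definition mps_ring :: "'v set \<Rightarrow> ('v, 'a::comm_ring_1) mps ring" where
  "mps_ring V =
     \<lparr>carrier = {f. \<forall>\<gamma>. mps_coeff f \<gamma> \<noteq> 0 \<longrightarrow> Poly_Mapping.keys \<gamma> \<subseteq> V},
      monoid.mult = (*), one = 1, ring.zero = 0, add = (+)\<rparr>"

lemma mps_ring_cring: "cring (mps_ring V :: ('v, 'a::comm_ring_1) mps ring)"
proof (intro cringI abelian_groupI comm_monoidI)
  let ?R = "mps_ring V :: ('v, 'a) mps ring"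
  {
    fix f g assume fg: "f \<in> carrier ?R" "g \<in> carrier ?R"
    then show "f \<oplus>\<^bsub>?R\<^esub> g \<in> carrier ?R"
      by (auto simp: mps_ring_def plus_mps_def) (metis add_0 subsetD)
    show "f \<otimes>\<^bsub>?R\<^esub> g \<in> carrier ?R"
    proof -
      have "Poly_Mapping.keys \<gamma> \<subseteq> V" if nz: "mps_coeff (f * g) \<gamma> \<noteq> 0" for \<gamma>
      proof -
        obtain p where p: "p \<in> {(\<alpha>, \<beta>). \<alpha> + \<beta> = \<gamma>}" "mps_coeff f (fst p) * mps_coeff g (snd p) \<noteq> 0"
          using nz unfolding times_mps_def mps_coeff_Abs case_prod_unfold
          by (meson sum.neutral)
        then have g: "\<gamma> = fst p + snd p" by auto
        from p(2) have "mps_coeff f (fst p) \<noteq> 0" "mps_coeff g (snd p) \<noteq> 0" by auto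
        with fg have "Poly_Mapping.keys (fst p) \<subseteq> V" "Poly_Mapping.keys (snd p) \<subseteq> V"
          by (auto simp: mps_ring_def)
        then show ?thesis
          unfolding g using Poly_Mapping.keys_add [of "fst p" "snd p"] by blast
      qed
      then show ?thesis by (simp add: mps_ring_def)
    qed
  }
  show "\<exists>g\<in>carrier ?R. g \<oplus>\<^bsub>?R\<^esub> f = \<zero>\<^bsub>?R\<^esub>" if "f \<in> carrier ?R" for f
  proof (rule bexI)
    show "- f \<oplus>\<^bsub>?R\<^esub> f = \<zero>\<^bsub>?R\<^esub>" by (simp add: mps_ring_def)
    show "- f \<in> carrier ?R" using that by (simp add: mps_ring_def uminus_mps_def)
  qed
  show "\<one>\<^bsub>?R\<^esub> \<in> carrier ?R" by (simp add: mps_ring_def one_mps_def)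
  show "\<zero>\<^bsub>?R\<^esub> \<in> carrier ?R" by (simp add: mps_ring_def zero_mps_def)
qed (auto simp: mps_ring_def algebra_simps)

text \<open>
  Substitution \<open>f \<mapsto> f(g\<^sub>j | j)\<close>. The sum is finite, coefficient by coefficient, when \<open>'v\<close> is
  finite and no \<open>g j\<close> has a constant term, which is the only case used.
\<close>

definition mps_subst ::
  "('v \<Rightarrow> ('u, 'a::comm_ring_1) mps) \<Rightarrow> ('v, 'a) mps \<Rightarrow> ('u, 'a) mps" where
  "mps_subst g f = Abs_mps (\<lambda>\<gamma>. Sum_any (\<lambda>\<alpha>.
     mps_coeff f \<alpha> * mps_coeff (\<Prod>j\<in>Poly_Mapping.keys \<alpha>. g j ^ Poly_Mapping.lookup \<alpha> j) \<gamma>))"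

definition colon_ideal :: "('a, 'b) ring_scheme \<Rightarrow> 'a set \<Rightarrow> 'a \<Rightarrow> 'a set" where
  "colon_ideal R J m = {f \<in> carrier R. f \<otimes>\<^bsub>R\<^esub> m \<in> J}"

section \<open>Toric ideals and initial ideals\<close>

text \<open>
  The polynomial ring over the complex numbers in variables indexed by \<open>'n\<close>; below it serves as
  \<open>\<complex>[\<partial>]\<close>, as \<open>\<complex>[\<theta>]\<close> and as the space \<open>\<complex>[x]\<close> on which the Weyl algebra acts.
\<close>

type_synonym 'n cpoly = "('n \<Rightarrow>\<^sub>0 nat) \<Rightarrow>\<^sub>0 complex"

abbreviation cpoly_ring :: "'n cpoly ring" where
  "cpoly_ring \<equiv> ring_of_type_algebra"

definition cpoly_const :: "complex \<Rightarrow> 'n cpoly" where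
  "cpoly_const c = Poly_Mapping.single 0 c"

definition cpoly_monom :: "('n \<Rightarrow>\<^sub>0 nat) \<Rightarrow> 'n cpoly" where
  "cpoly_monom \<alpha> = Poly_Mapping.single \<alpha> 1"

definition cpoly_var :: "'n \<Rightarrow> 'n cpoly" where
  "cpoly_var j = cpoly_monom (Poly_Mapping.single j 1)"

definition cpoly_eval :: "complex ^ 'n \<Rightarrow> 'n cpoly \<Rightarrow> complex" where
  "cpoly_eval v f = (\<Sum>\<alpha>\<in>Poly_Mapping.keys f.
     Poly_Mapping.lookup f \<alpha> * (\<Prod>j\<in>UNIV. v $ j ^ Poly_Mapping.lookup \<alpha> j))"

definition toric_ideal :: "int ^ 'n ^ 'd \<Rightarrow> 'n cpoly set" where
  "toric_ideal A = Idl\<^bsub>cpoly_ring\<^esub>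
     {cpoly_monom u - cpoly_monom v | u v.
        \<forall>i. (\<Sum>j\<in>UNIV. A $ i $ j * int (Poly_Mapping.lookup u j)) =
            (\<Sum>j\<in>UNIV. A $ i $ j * int (Poly_Mapping.lookup v j))}"

definition weight :: "real ^ 'n \<Rightarrow> ('n \<Rightarrow>\<^sub>0 nat) \<Rightarrow> real" where
  "weight w \<alpha> = (\<Sum>j\<in>UNIV. w $ j * real (Poly_Mapping.lookup \<alpha> j))"

definition initial_form :: "real ^ 'n \<Rightarrow> 'n cpoly \<Rightarrow> 'n cpoly" where
  "initial_form w f =
     (\<Sum>\<alpha> | \<alpha> \<in> Poly_Mapping.keys f \<and> (\<forall>\<beta>\<in>Poly_Mapping.keys f. weight w \<beta> \<le> weight w \<alpha>).
        Poly_Mapping.single \<alpha> (Poly_Mapping.lookup f \<alpha>))"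

definition initial_ideal :: "real ^ 'n \<Rightarrow> 'n cpoly set \<Rightarrow> 'n cpoly set" where
  "initial_ideal w I = Idl\<^bsub>cpoly_ring\<^esub> (initial_form w ` I)"

definition monomial_ideal :: "'n cpoly set \<Rightarrow> bool" where
  "monomial_ideal I \<longleftrightarrow> (\<exists>E. I = Idl\<^bsub>cpoly_ring\<^esub> (cpoly_monom ` E))"

section \<open>The Weyl algebra and fake exponents\<close>

definition x_op :: "'n \<Rightarrow> 'n cpoly \<Rightarrow> 'n cpoly" where
  "x_op j p = cpoly_var j * p"

text \<open>When \<open>\<alpha>\<^sub>j = 0\<close> the truncated subtraction is harmless: the coefficient is \<open>0\<close>.\<close>

definition d_op :: "'n \<Rightarrow> 'n cpoly \<Rightarrow> 'n cpoly" where
  "d_op j p = (\<Sum>\<alpha>\<in>Poly_Mapping.keys p.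
     Poly_Mapping.single (\<alpha> - Poly_Mapping.single j 1)
       (of_nat (Poly_Mapping.lookup \<alpha> j) * Poly_Mapping.lookup p \<alpha>))"

definition theta_op :: "'n \<Rightarrow> 'n cpoly \<Rightarrow> 'n cpoly" where
  "theta_op j = x_op j \<circ> d_op j"

text \<open>
  The Weyl algebra \<open>D\<close>, realized as the algebra of linear operators on \<open>\<complex>[x]\<close> generated by the
  multiplications by \<open>x\<^sub>j\<close> and the partial derivatives; its product is composition.
\<close>

inductive_set weyl_algebra :: "('n cpoly \<Rightarrow> 'n cpoly) set" where
  const: "(\<lambda>p. cpoly_const c * p) \<in> weyl_algebra"
| x: "x_op j \<in> weyl_algebra"
| d: "d_op j \<in> weyl_algebra"
| add: "P \<in> weyl_algebra \<Longrightarrow> Q \<in> weyl_algebra \<Longrightarrow> (\<lambda>p. P p + Q p) \<in> weyl_algebra"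
| mult: "P \<in> weyl_algebra \<Longrightarrow> Q \<in> weyl_algebra \<Longrightarrow> P \<circ> Q \<in> weyl_algebra"

definition weyl_left_ideal :: "('n cpoly \<Rightarrow> 'n cpoly) set \<Rightarrow> ('n cpoly \<Rightarrow> 'n cpoly) set" where
  "weyl_left_ideal G =
     {(\<lambda>p. \<Sum>i<k. P i (g i p)) | (k::nat) P g. \<forall>i<k. P i \<in> weyl_algebra \<and> g i \<in> G}"

text \<open>
  The operator \<open>f(T\<^sub>j | j)\<close> for pairwise commuting operators \<open>T j\<close>. For \<open>T = d_op\<close> and
  \<open>T = theta_op\<close> this embeds \<open>\<complex>[\<partial>]\<close> and \<open>\<complex>[\<theta>]\<close> into \<open>D\<close>.
\<close>

definition op_eval ::
  "('n::finite \<Rightarrow> 'n cpoly \<Rightarrow> 'n cpoly) \<Rightarrow> 'n cpoly \<Rightarrow> 'n cpoly \<Rightarrow> 'n cpoly" where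
  "op_eval T f p = (\<Sum>\<alpha>\<in>Poly_Mapping.keys f.
     cpoly_const (Poly_Mapping.lookup f \<alpha>) * Finite_Set.fold (\<lambda>j. T j ^^ Poly_Mapping.lookup \<alpha> j) p UNIV)"

definition fake_indicial_ideal ::
  "int ^ 'n ^ 'd \<Rightarrow> complex ^ 'd \<Rightarrow> real ^ 'n \<Rightarrow> 'n::finite cpoly set" where
  "fake_indicial_ideal A \<beta> w =
     {f. op_eval theta_op f \<in> weyl_left_ideal (op_eval d_op ` initial_ideal w (toric_ideal A))}
     <+>\<^bsub>cpoly_ring\<^esub>
     Idl\<^bsub>cpoly_ring\<^esub>
       {(\<Sum>j\<in>UNIV. cpoly_const (of_int (A $ i $ j)) * cpoly_var j) - cpoly_const (\<beta> $ i) | i. True}"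

definition fake_exponent ::
  "int ^ 'n ^ 'd \<Rightarrow> complex ^ 'd \<Rightarrow> real ^ 'n \<Rightarrow> complex ^ 'n::finite \<Rightarrow> bool" where
  "fake_exponent A \<beta> w v \<longleftrightarrow> (\<forall>f \<in> fake_indicial_ideal A \<beta> w. cpoly_eval v f = 0)"

section \<open>Negative supports\<close>

definition int_kernel :: "int ^ 'n ^ 'd \<Rightarrow> (int ^ 'n) set" where
  "int_kernel A = {u. A *v u = 0}"

definition complex_kernel :: "int ^ 'n ^ 'd \<Rightarrow> (complex ^ 'n) set" where
  "complex_kernel A = {u. map_matrix of_int A *v u = 0}"

definition nsupp :: "complex ^ 'n \<Rightarrow> int ^ 'n \<Rightarrow> 'n set" where
  "nsupp v u = {j. \<exists>k::int. k < 0 \<and> v $ j + of_int (u $ j) = of_int k}"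

definition NS :: "int ^ 'n ^ 'd \<Rightarrow> complex ^ 'n \<Rightarrow> 'n set set" where
  "NS A v = nsupp v ` int_kernel A"

definition minimal_NS ::
  "int ^ 'n ^ 'd \<Rightarrow> real ^ 'n \<Rightarrow> complex ^ 'n \<Rightarrow> 'n set set" where
  "minimal_NS A w v = {I \<in> NS A v. \<forall>u \<in> int_kernel A.
     nsupp v u = I \<longrightarrow> (\<Sum>j\<in>UNIV. w $ j * of_int (u $ j)) \<ge> 0}"

definition neg_supp_family ::
  "int ^ 'n ^ 'd \<Rightarrow> real ^ 'n \<Rightarrow> complex ^ 'n \<Rightarrow> 'n set set \<Rightarrow> bool" where
  "neg_supp_family A w v N \<longleftrightarrow> nsupp v 0 \<in> N \<and> N \<subseteq> minimal_NS A w v"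

definition ordered_family :: "int ^ 'n ^ 'd \<Rightarrow> complex ^ 'n \<Rightarrow> 'n set set \<Rightarrow> bool" where
  "ordered_family A v N \<longleftrightarrow> (\<forall>I \<in> N. \<forall>J \<in> NS A v. J \<subseteq> I \<longrightarrow> J \<in> N)"

section \<open>The ambient side\<close>

abbreviation t_ring :: "('n, complex) mps ring" where
  "t_ring \<equiv> mps_ring UNIV"

definition t_monom :: "'n set \<Rightarrow> ('n, complex) mps" where
  "t_monom S = (\<Prod>j\<in>S. mps_var j)"

definition m_hat :: "complex ^ 'n \<Rightarrow> 'n set set \<Rightarrow> ('n, complex) mps" where
  "m_hat v N = t_monom (nsupp v 0 - \<Inter>N)"

definition M_hat :: "'n set set \<Rightarrow> ('n, complex) mps set" where
  "M_hat N = Idl\<^bsub>t_ring\<^esub> {t_monom (I - \<Inter>N) | I. I \<in> N}"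

definition P_hat :: "int ^ 'n ^ 'd \<Rightarrow> complex ^ 'n \<Rightarrow> 'n set set \<Rightarrow> ('n, complex) mps set" where
  "P_hat A v N = Idl\<^bsub>t_ring\<^esub> {t_monom ((I \<union> J) - \<Inter>N) | I J. I \<in> N \<and> J \<in> NS A v - N}"

definition At_ideal :: "int ^ 'n ^ 'd \<Rightarrow> ('n, complex) mps set" where
  "At_ideal A = Idl\<^bsub>t_ring\<^esub> {\<Sum>j\<in>UNIV. mps_const (of_int (A $ i $ j)) * mps_var j | i. True}"

definition Q_hat :: "int ^ 'n ^ 'd \<Rightarrow> complex ^ 'n \<Rightarrow> 'n set set \<Rightarrow> ('n, complex) mps set" where
  "Q_hat A v N = (At_ideal A \<cdot>\<^bsub>t_ring\<^esub> M_hat N) <+>\<^bsub>t_ring\<^esub> P_hat A v N"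

section \<open>The intrinsic side\<close>

text \<open>
  The matrix \<open>B\<close> is the family \<open>b 0, b 1, \<dots>, b (n - d - 1)\<close> of its columns; the variables
  \<open>s\<close> are indexed by \<open>{..<n - d}\<close>.
\<close>

abbreviation s_ring :: "nat \<Rightarrow> (nat, complex) mps ring" where
  "s_ring m \<equiv> mps_ring {..<m}"

definition kernel_basis :: "int ^ 'n ^ 'd \<Rightarrow> nat \<Rightarrow> (nat \<Rightarrow> complex ^ 'n) \<Rightarrow> bool" where
  "kernel_basis A m b \<longleftrightarrow> inj_on b {..<m} \<and> vec.independent (b ` {..<m}) \<and>
     vec.span (b ` {..<m}) = complex_kernel A"

definition Bs :: "nat \<Rightarrow> (nat \<Rightarrow> complex ^ 'n) \<Rightarrow> 'n \<Rightarrow> (nat, complex) mps" where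
  "Bs m b j = (\<Sum>k<m. mps_const (b k $ j) * mps_var k)"

definition Bs_monom :: "nat \<Rightarrow> (nat \<Rightarrow> complex ^ 'n) \<Rightarrow> 'n set \<Rightarrow> (nat, complex) mps" where
  "Bs_monom m b S = (\<Prod>j\<in>S. Bs m b j)"

definition m_intr ::
  "complex ^ 'n \<Rightarrow> nat \<Rightarrow> (nat \<Rightarrow> complex ^ 'n) \<Rightarrow> 'n set set \<Rightarrow> (nat, complex) mps" where
  "m_intr v m b N = Bs_monom m b (nsupp v 0 - \<Inter>N)"

definition P_intr ::
  "int ^ 'n ^ 'd \<Rightarrow> complex ^ 'n \<Rightarrow> nat \<Rightarrow> (nat \<Rightarrow> complex ^ 'n) \<Rightarrow> 'n set set
     \<Rightarrow> (nat, complex) mps set" where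
  "P_intr A v m b N = Idl\<^bsub>s_ring m\<^esub>
     {Bs_monom m b ((I \<union> J) - \<Inter>N) | I J. I \<in> N \<and> J \<in> NS A v - N}"

definition Phi ::
  "nat \<Rightarrow> (nat \<Rightarrow> complex ^ 'n) \<Rightarrow> ('n, complex) mps \<Rightarrow> (nat, complex) mps" where
  "Phi m b = mps_subst (Bs m b)"

end

theory Submission
  imports Defs
begin

text \<open>
  The substitution \<open>\<Phi>\<close> maps \<open>\<complex>[[t]]\<close> onto \<open>\<complex>[[s]]\<close> with kernel \<open>\<langle>A t\<rangle>\<close>, and it sends the generators of
  \<open>P_hat\<close> to those of \<open>P_intr\<close>. If \<open>\<Phi>(f) m \<in> P_intr\<close>, then \<open>f m_hat - p\<close> lies in the kernel for some
  \<open>p \<in> P_hat\<close>, and it also lies in \<open>M_hat\<close>; hence \<open>f\<close> belongs to the second colon ideal of the hypothesis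
  and so to the first one.

  For the kernel, let \<open>\<Psi>\<close> be the substitution \<open>s = C t\<close> for a left inverse \<open>C\<close> of \<open>B\<close>. Then \<open>\<Phi> \<circ> \<Psi>\<close> is
  the identity, and telescoping the monomials of \<open>f\<close> writes \<open>f - \<Psi>(\<Phi>(f))\<close> as a combination of the
  linear forms \<open>t\<^sub>j - (B C t)\<^sub>j\<close>. These are combinations of the rows of \<open>A t\<close>, because \<open>1 - B C\<close>
  vanishes on the kernel of \<open>A\<close>.
\<close>

section \<open>Coefficients and the order filtration\<close>

lemma mps_coeff_simps [simp]:
  "mps_coeff 0 \<gamma> = 0"
  "mps_coeff (f + g) \<gamma> = mps_coeff f \<gamma> + mps_coeff g \<gamma>"
  "mps_coeff (f - g) \<gamma> = mps_coeff f \<gamma> - mps_coeff g \<gamma>"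
  "mps_coeff (- f) \<gamma> = - mps_coeff f \<gamma>"
  by (simp_all add: zero_mps_def plus_mps_def minus_mps_def uminus_mps_def)

lemma mps_coeff_sum: "mps_coeff (sum F S) \<gamma> = (\<Sum>i\<in>S. mps_coeff (F i) \<gamma>)"
  by (induction S rule: infinite_finite_induct) auto

lemma mps_coeff_mult:
  "mps_coeff (f * g) \<gamma> = (\<Sum>p\<in>{(\<alpha>, \<beta>). \<alpha> + \<beta> = \<gamma>}. mps_coeff f (fst p) * mps_coeff g (snd p))"
  by (simp add: times_mps_def case_prod_unfold)

definition mps_mono :: "('v \<Rightarrow>\<^sub>0 nat) \<Rightarrow> ('v, 'a::comm_ring_1) mps" where
  "mps_mono \<alpha> = Abs_mps (\<lambda>\<gamma>. if \<gamma> = \<alpha> then 1 else 0)"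

lemma mps_coeff_mono: "mps_coeff (mps_mono \<alpha>) \<gamma> = (if \<gamma> = \<alpha> then 1 else 0)"
  by (simp add: mps_mono_def)

lemma mps_mono_0: "mps_mono 0 = 1"
  by (simp add: mps_mono_def one_mps_def)

lemma mps_mono_single: "mps_mono (Poly_Mapping.single j 1) = mps_var j"
  by (simp add: mps_mono_def mps_var_def)

lemma mps_mono_add: "mps_mono (\<alpha> + \<beta>) = mps_mono \<alpha> * mps_mono \<beta>"
proof (rule mps_eqI)
  fix \<gamma> :: "'a \<Rightarrow>\<^sub>0 nat"
  have "mps_coeff (mps_mono \<alpha> * mps_mono \<beta> :: ('a, 'b) mps) \<gamma> =
      (\<Sum>p\<in>{(\<alpha>, \<beta>). \<alpha> + \<beta> = \<gamma>}. if p = (\<alpha>, \<beta>) then 1 else 0)"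
    unfolding mps_coeff_mult by (rule sum.cong) (auto simp: mps_coeff_mono)
  also have "\<dots> = (if \<gamma> = \<alpha> + \<beta> then 1 else 0)"
    by (subst sum.delta) auto
  finally show "mps_coeff (mps_mono (\<alpha> + \<beta>)) \<gamma> = mps_coeff (mps_mono \<alpha> * mps_mono \<beta> :: ('a, 'b) mps) \<gamma>"
    by (simp add: mps_coeff_mono)
qed

lemma mps_coeff_const_mult [simp]: "mps_coeff (mps_const c * f) \<gamma> = c * mps_coeff f \<gamma>"
proof -
  have "mps_coeff (mps_const c * f) \<gamma> =
      (\<Sum>p\<in>{(\<alpha>, \<beta>). \<alpha> + \<beta> = \<gamma>}. if p = (0, \<gamma>) then c * mps_coeff f \<gamma> else 0)"
    unfolding mps_coeff_mult by (rule sum.cong) (auto simp: mps_const_def)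
  also have "\<dots> = c * mps_coeff f \<gamma>"
    by (subst sum.delta) auto
  finally show ?thesis .
qed

lemma mps_coeff_const: "mps_coeff (mps_const c) \<gamma> = (if \<gamma> = 0 then c else 0)"
  by (simp add: mps_const_def)

lemma mps_const_mult: "mps_const (c * d) = mps_const c * mps_const d"
  by (rule mps_eqI) (auto simp: mps_coeff_const)

lemma mps_const_0 [simp]: "mps_const 0 = 0"
  by (rule mps_eqI) (auto simp: mps_coeff_const)

lemma mps_const_1 [simp]: "mps_const 1 = 1"
  by (simp add: mps_const_def one_mps_def)

lemma mps_const_diff: "mps_const (c - d) = mps_const c - mps_const d"
  by (rule mps_eqI) (auto simp: mps_coeff_const)

lemma mps_const_sum: "mps_const (sum F S) = (\<Sum>i\<in>S. mps_const (F i))"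
  by (rule mps_eqI) (auto simp: mps_coeff_const mps_coeff_sum)

section \<open>Total degree and lower bounds on the order of a series\<close>

text \<open>Summing over the keys keeps the degree meaningful for an infinite index type, as for the
  variables \<open>s\<close> indexed by \<open>nat\<close>.\<close>

definition tdeg :: "('v \<Rightarrow>\<^sub>0 nat) \<Rightarrow> nat" where
  "tdeg \<alpha> = (\<Sum>j\<in>Poly_Mapping.keys \<alpha>. Poly_Mapping.lookup \<alpha> j)"

lemma tdeg_0 [simp]: "tdeg 0 = 0"
  by (simp add: tdeg_def)

lemma tdeg_single [simp]: "tdeg (Poly_Mapping.single j n) = n"
  by (simp add: tdeg_def)

lemma tdeg_add: "tdeg (\<alpha> + \<beta>) = tdeg \<alpha> + tdeg \<beta>"
  unfolding tdeg_def by (rule setsum_keys_plus_distrib) auto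

lemma tdeg_eq_0_iff [simp]: "tdeg \<alpha> = 0 \<longleftrightarrow> \<alpha> = 0"
  by (auto simp: tdeg_def in_keys_iff intro!: poly_mapping_eqI)

text \<open>Removing one unit from a variable that occurs in a nonzero exponent lowers the total
  degree by one. In this form the induction multiplies a monomial by one variable at a time.\<close>

lemma tdeg_induct [case_names zero add_single]:
  fixes \<alpha> :: "'v \<Rightarrow>\<^sub>0 nat"
  assumes zero: "P 0" and add: "\<And>\<beta> i. P \<beta> \<Longrightarrow> P (\<beta> + Poly_Mapping.single i 1)"
  shows "P \<alpha>"
proof (induction "tdeg \<alpha>" arbitrary: \<alpha>)
  case 0
  then show ?case using zero by simp
next
  case (Suc n)
  then have "\<alpha> \<noteq> 0" by auto
  then obtain i where i: "Poly_Mapping.lookup \<alpha> i \<noteq> 0"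
    by (metis lookup_zero poly_mapping_eqI)
  \<comment> \<open>The subtraction is not truncated here, because the variable \<open>i\<close>
    occurs in \<open>\<alpha>\<close>.\<close>
  define \<beta> where "\<beta> = \<alpha> - Poly_Mapping.single i 1"
  have \<alpha>: "\<alpha> = \<beta> + Poly_Mapping.single i 1"
    using i by (intro poly_mapping_eqI) (auto simp: \<beta>_def lookup_add lookup_minus lookup_single when_def)
  then have "tdeg \<alpha> = tdeg \<beta> + 1" by (simp only: tdeg_add tdeg_single)
  with Suc have "P \<beta>" by simp
  then show ?case unfolding \<alpha> by (rule add)
qed

lemma lookup_le_tdeg: "Poly_Mapping.lookup \<alpha> j \<le> tdeg \<alpha>"
  by (cases "j \<in> Poly_Mapping.keys \<alpha>") (auto simp: tdeg_def in_keys_iff intro: member_le_sum)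

text \<open>Each single exponent is at most the total degree, so these exponents embed into the
  functions from a finite set to \<open>{..n}\<close>. This is the source of all finiteness
  below.\<close>

lemma finite_tdeg_le:
  assumes "finite V"
  shows "finite {\<alpha>. Poly_Mapping.keys \<alpha> \<subseteq> V \<and> tdeg \<alpha> \<le> n}" (is "finite ?S")
proof -
  let ?F = "{h. \<forall>x. (x \<in> V \<longrightarrow> h x \<in> {..n}) \<and> (x \<notin> V \<longrightarrow> h x = (0::nat))}"
  have "finite ?F"
    using assms by (intro finite_set_of_finite_funs) simp_all
  moreover have "Poly_Mapping.lookup ` ?S \<subseteq> ?F"
    by (intro image_subsetI CollectI allI conjI)
       (auto simp: in_keys_iff intro: order_trans [OF lookup_le_tdeg])
  ultimately have "finite (Poly_Mapping.lookup ` ?S)"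
    by (rule finite_subset [rotated])
  moreover have "inj_on Poly_Mapping.lookup ?S"
    by (simp add: inj_on_def Poly_Mapping.lookup_inject)
  ultimately show ?thesis by (rule finite_imageD)
qed

text \<open>A lower bound on the order rather than the order itself, so that the series 0 needs no
  separate treatment.\<close>

definition ord_ge :: "nat \<Rightarrow> ('v, 'a::comm_ring_1) mps \<Rightarrow> bool" where
  "ord_ge n f \<longleftrightarrow> (\<forall>\<gamma>. tdeg \<gamma> < n \<longrightarrow> mps_coeff f \<gamma> = 0)"

lemma ord_ge_0 [simp]: "ord_ge 0 f"
  by (simp add: ord_ge_def)

lemma ord_ge_zero [simp]: "ord_ge n 0"
  by (simp add: ord_ge_def)

lemma ord_ge_add: "ord_ge n f \<Longrightarrow> ord_ge n g \<Longrightarrow> ord_ge n (f + g)"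
  by (simp add: ord_ge_def)

lemma ord_ge_diff: "ord_ge n f \<Longrightarrow> ord_ge n g \<Longrightarrow> ord_ge n (f - g)"
  by (simp add: ord_ge_def)

lemma ord_ge_sum: "(\<And>i. i \<in> S \<Longrightarrow> ord_ge n (F i)) \<Longrightarrow> ord_ge n (sum F S)"
  by (simp add: ord_ge_def mps_coeff_sum)

lemma ord_ge_mono: "ord_ge n f \<Longrightarrow> k \<le> n \<Longrightarrow> ord_ge k f"
  by (simp add: ord_ge_def)

lemma ord_ge_mult:
  assumes "ord_ge k f" "ord_ge l g"
  shows "ord_ge (k + l) (f * g)"
  unfolding ord_ge_def
proof (intro allI impI)
  fix \<gamma> :: "'a \<Rightarrow>\<^sub>0 nat" assume \<gamma>: "tdeg \<gamma> < k + l"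
  have "mps_coeff f (fst p) * mps_coeff g (snd p) = 0" if "p \<in> {(\<alpha>, \<beta>). \<alpha> + \<beta> = \<gamma>}" for p
  proof -
    from that have "tdeg (fst p) + tdeg (snd p) = tdeg \<gamma>" by (auto simp: tdeg_add)
    with \<gamma> have "tdeg (fst p) < k \<or> tdeg (snd p) < l" by linarith
    with assms show ?thesis by (auto simp: ord_ge_def)
  qed
  then show "mps_coeff (f * g) \<gamma> = 0"
    unfolding mps_coeff_mult by (intro sum.neutral) blast
qed

lemma ord_ge_mult_left: "ord_ge n f \<Longrightarrow> ord_ge n (g * f)"
  using ord_ge_mult [of 0 g n f] by simp

lemma ord_ge_mult_right: "ord_ge n f \<Longrightarrow> ord_ge n (f * g)"
  using ord_ge_mult [of n f 0 g] by simp

lemma ord_ge_power: "ord_ge 1 f \<Longrightarrow> ord_ge k (f ^ k)"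
  using ord_ge_mult [of 1 f] by (induction k) auto

text \<open>The filtration by order is separated. Identities between series are thereby reduced to
  identities between truncations, up to an error of arbitrarily high order.\<close>

lemma mps_eq_if_ord_ge:
  assumes "\<And>n. ord_ge n (f - g)"
  shows "f = g"
proof (rule mps_eqI)
  fix \<gamma>
  show "mps_coeff f \<gamma> = mps_coeff g \<gamma>"
    using assms [of "Suc (tdeg \<gamma>)"] by (auto simp: ord_ge_def)
qed

lemma ord_ge_1_var: "ord_ge 1 (mps_var j)"
  by (simp add: ord_ge_def mps_coeff_mono del: One_nat_def flip: mps_mono_single)
     (metis tdeg_single tdeg_eq_0_iff zero_neq_one)

section \<open>Power products of a family of series\<close>

definition mps_pow :: "('v \<Rightarrow> ('u, 'a::comm_ring_1) mps) \<Rightarrow> ('v \<Rightarrow>\<^sub>0 nat) \<Rightarrow> ('u, 'a) mps" where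
  "mps_pow g \<alpha> = (\<Prod>j\<in>Poly_Mapping.keys \<alpha>. g j ^ Poly_Mapping.lookup \<alpha> j)"

lemma mps_pow_superset:
  assumes "finite S" "Poly_Mapping.keys \<alpha> \<subseteq> S"
  shows "mps_pow g \<alpha> = (\<Prod>j\<in>S. g j ^ Poly_Mapping.lookup \<alpha> j)"
  unfolding mps_pow_def using assms by (intro prod.mono_neutral_left) (auto simp: in_keys_iff)

lemma mps_pow_0 [simp]: "mps_pow g 0 = 1"
  by (simp add: mps_pow_def)

lemma mps_pow_single [simp]: "mps_pow g (Poly_Mapping.single j 1) = g j"
  by (simp add: mps_pow_def)

lemma mps_pow_add: "mps_pow g (\<alpha> + \<beta>) = mps_pow g \<alpha> * mps_pow g \<beta>"
proof -
  let ?S = "Poly_Mapping.keys \<alpha> \<union> Poly_Mapping.keys \<beta>"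
  have "mps_pow g \<delta> = (\<Prod>j\<in>?S. g j ^ Poly_Mapping.lookup \<delta> j)"
    if "\<delta> \<in> {\<alpha>, \<beta>, \<alpha> + \<beta>}" for \<delta>
    using that Poly_Mapping.keys_add [of \<alpha> \<beta>] by (intro mps_pow_superset) auto
  then show ?thesis
    by (simp add: prod.distrib [symmetric] power_add lookup_add)
qed

lemma mps_pow_var: "mps_pow mps_var \<alpha> = mps_mono \<alpha>"
  by (induction \<alpha> rule: tdeg_induct)
     (simp_all add: mps_mono_0 mps_pow_add mps_mono_add mps_mono_single del: One_nat_def)

text \<open>Each of the |\<alpha>| factors, counted with multiplicity, contributes at least one to
  the order.\<close>

lemma ord_ge_pow:
  assumes "\<And>j. ord_ge 1 (g j)"
  shows "ord_ge (tdeg \<alpha>) (mps_pow g \<alpha>)"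
proof -
  have "ord_ge (\<Sum>j\<in>S. Poly_Mapping.lookup \<alpha> j) (\<Prod>j\<in>S. g j ^ Poly_Mapping.lookup \<alpha> j)"
    if "finite S" for S
    using that by (induction S) (auto intro: ord_ge_mult ord_ge_power assms)
  then show ?thesis by (simp add: tdeg_def mps_pow_def)
qed

section \<open>The rings of power series\<close>

lemma carrier_mps_ring:
  "carrier (mps_ring V) = {f. \<forall>\<gamma>. mps_coeff f \<gamma> \<noteq> 0 \<longrightarrow> Poly_Mapping.keys \<gamma> \<subseteq> V}"
  by (simp add: mps_ring_def)

lemma mps_ring_simps [simp]:
  "f \<otimes>\<^bsub>mps_ring V\<^esub> g = f * g"
  "f \<oplus>\<^bsub>mps_ring V\<^esub> g = f + g"
  "\<one>\<^bsub>mps_ring V\<^esub> = 1"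
  "\<zero>\<^bsub>mps_ring V\<^esub> = 0"
  by (simp_all add: mps_ring_def)

lemma carrier_t_ring [simp]: "carrier (mps_ring UNIV) = UNIV"
  by (simp add: carrier_mps_ring)

lemma mps_ring_zero [intro]: "0 \<in> carrier (mps_ring V)"
  by (simp add: carrier_mps_ring)

lemma mps_ring_add [intro]:
  "f \<in> carrier (mps_ring V) \<Longrightarrow> g \<in> carrier (mps_ring V) \<Longrightarrow> f + g \<in> carrier (mps_ring V)"
  using cring.cring_simprules(1) [OF mps_ring_cring, of f V g] by simp

lemma mps_ring_diff [intro]:
  "f \<in> carrier (mps_ring V) \<Longrightarrow> g \<in> carrier (mps_ring V) \<Longrightarrow> f - g \<in> carrier (mps_ring V)"
  by (auto simp: carrier_mps_ring) (metis diff_0_right subsetD)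

lemma mps_ring_mult [intro]:
  "f \<in> carrier (mps_ring V) \<Longrightarrow> g \<in> carrier (mps_ring V) \<Longrightarrow> f * g \<in> carrier (mps_ring V)"
  using cring.cring_simprules(5) [OF mps_ring_cring, of f V g] by simp

lemma mps_ring_one [intro]: "1 \<in> carrier (mps_ring V)"
  using cring.cring_simprules(6) [OF mps_ring_cring, of V] by simp

lemma mps_ring_sum [intro]:
  "(\<And>i. i \<in> S \<Longrightarrow> F i \<in> carrier (mps_ring V)) \<Longrightarrow> sum F S \<in> carrier (mps_ring V)"
  by (induction S rule: infinite_finite_induct) auto

lemma mps_ring_power [intro]:
  "f \<in> carrier (mps_ring V) \<Longrightarrow> f ^ k \<in> carrier (mps_ring V)"
  by (induction k) auto

lemma mps_ring_prod [intro]: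
  "(\<And>i. i \<in> S \<Longrightarrow> F i \<in> carrier (mps_ring V)) \<Longrightarrow> prod F S \<in> carrier (mps_ring V)"
  by (induction S rule: infinite_finite_induct) auto

lemma mps_ring_const [intro]: "mps_const c \<in> carrier (mps_ring V)"
  by (auto simp: carrier_mps_ring mps_coeff_const split: if_splits)

lemma mps_ring_mono [intro]:
  "Poly_Mapping.keys \<alpha> \<subseteq> V \<Longrightarrow> mps_mono \<alpha> \<in> carrier (mps_ring V)"
  by (auto simp: carrier_mps_ring mps_coeff_mono split: if_splits)

lemma mps_ring_var [intro]: "j \<in> V \<Longrightarrow> mps_var j \<in> carrier (mps_ring V)"
  by (auto simp flip: mps_mono_single intro!: mps_ring_mono)

text \<open>The Taylor polynomial of degree at most \<open>n\<close> in the variables of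
  \<open>V\<close>: a finite sum, on which substitution can be computed term by term.\<close>

definition mps_trunc :: "'v set \<Rightarrow> nat \<Rightarrow> ('v, 'a::comm_ring_1) mps \<Rightarrow> ('v, 'a) mps" where
  "mps_trunc V n f =
    (\<Sum>\<alpha> | Poly_Mapping.keys \<alpha> \<subseteq> V \<and> tdeg \<alpha> \<le> n. mps_const (mps_coeff f \<alpha>) * mps_mono \<alpha>)"

lemma mps_trunc_in_ring [intro]: "mps_trunc V n f \<in> carrier (mps_ring V)"
  unfolding mps_trunc_def by (intro mps_ring_sum mps_ring_mult mps_ring_const mps_ring_mono) auto

text \<open>An exponent of degree below \<open>n\<close> either uses only variables of
  \<open>V\<close>, and then the truncation keeps its coefficient, or its coefficient in
  \<open>f\<close> is 0.\<close>

lemma ord_ge_diff_trunc: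
  assumes "finite V" "f \<in> carrier (mps_ring V)"
  shows "ord_ge n (f - mps_trunc V n f)"
  unfolding ord_ge_def
proof (intro allI impI)
  fix \<gamma> :: "'a \<Rightarrow>\<^sub>0 nat" assume \<gamma>: "tdeg \<gamma> < n"
  let ?S = "{\<alpha>. Poly_Mapping.keys \<alpha> \<subseteq> V \<and> tdeg \<alpha> \<le> n}"
  have "mps_coeff (mps_trunc V n f) \<gamma> = (\<Sum>\<alpha>\<in>?S. if \<gamma> = \<alpha> then mps_coeff f \<gamma> else 0)"
    unfolding mps_trunc_def mps_coeff_sum by (rule sum.cong) (auto simp: mps_coeff_mono)
  also have "\<dots> = mps_coeff f \<gamma>"
    using finite_tdeg_le [OF assms(1), of n] \<gamma> assms(2)
    by (subst sum.delta') (auto simp: carrier_mps_ring)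
  finally show "mps_coeff (f - mps_trunc V n f) \<gamma> = 0" by simp
qed

section \<open>Substitution\<close>

text \<open>Finitely many variables and no constant terms make substitution well defined. The set
  \<open>V\<close> is separate from the index type so that both \<Phi> (all \<open>t\<close>) and
  \<Psi> (the \<open>s\<close> with index below \<open>m\<close>) are instances.\<close>

locale mps_substitution =
  fixes V :: "'v set" and g :: "'v \<Rightarrow> ('u, 'a::comm_ring_1) mps"
  assumes finite_vars: "finite V" and ord_g: "\<And>j. ord_ge 1 (g j)"
begin

abbreviation "R \<equiv> carrier (mps_ring V :: ('v, 'a) mps ring)"

lemma coeff_subst:
  "mps_coeff (mps_subst g f) \<gamma> = Sum_any (\<lambda>\<alpha>. mps_coeff f \<alpha> * mps_coeff (mps_pow g \<alpha>) \<gamma>)"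
  by (simp add: mps_subst_def mps_pow_def)

lemma coeff_pow_eq_0: "tdeg \<gamma> < tdeg \<alpha> \<Longrightarrow> mps_coeff (mps_pow g \<alpha>) \<gamma> = 0"
  using ord_ge_pow [of g \<alpha>, OF ord_g] by (simp add: ord_ge_def)

text \<open>Since g^\<alpha> has order at least |\<alpha>|, only exponents with |\<alpha>| \<le>
  |\<gamma>| contribute. Finiteness is essential because \<open>Sum_any\<close> is 0 on infinite
  support and would not be additive there.\<close>

lemma finite_support:
  assumes "f \<in> R"
  shows "finite {\<alpha>. mps_coeff f \<alpha> * mps_coeff (mps_pow g \<alpha>) \<gamma> \<noteq> 0}"
proof (rule finite_subset [OF _ finite_tdeg_le [OF finite_vars, of "tdeg \<gamma>"]])
  show "{\<alpha>. mps_coeff f \<alpha> * mps_coeff (mps_pow g \<alpha>) \<gamma> \<noteq> 0} \<subseteq> {\<alpha>. Poly_Mapping.keys \<alpha> \<subseteq> V \<and> tdeg \<alpha> \<le> tdeg \<gamma>}"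
  proof (rule subsetI, clarsimp, intro conjI)
    fix \<alpha> assume nz: "mps_coeff f \<alpha> * mps_coeff (mps_pow g \<alpha>) \<gamma> \<noteq> 0"
    then have "mps_coeff f \<alpha> \<noteq> 0" by auto
    with assms show "Poly_Mapping.keys \<alpha> \<subseteq> V" by (simp add: carrier_mps_ring)
    from nz show "tdeg \<alpha> \<le> tdeg \<gamma>" using coeff_pow_eq_0 [of \<gamma> \<alpha>] by (cases "tdeg \<gamma> < tdeg \<alpha>") auto
  qed
qed

lemma subst_add:
  assumes "f \<in> R" "h \<in> R"
  shows "mps_subst g (f + h) = mps_subst g f + mps_subst g h"
  by (rule mps_eqI)
     (simp add: coeff_subst distrib_right Sum_any.distrib finite_support assms)

lemma subst_0 [simp]: "mps_subst g 0 = 0"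
  by (rule mps_eqI) (simp add: coeff_subst)

lemma subst_diff:
  assumes "f \<in> R" "h \<in> R"
  shows "mps_subst g (f - h) = mps_subst g f - mps_subst g h"
  using subst_add [OF mps_ring_diff [OF assms] assms(2)] by (simp add: algebra_simps)

lemma subst_sum:
  assumes "\<And>i. i \<in> S \<Longrightarrow> F i \<in> R"
  shows "mps_subst g (sum F S) = (\<Sum>i\<in>S. mps_subst g (F i))"
  using assms
  by (induction S rule: infinite_finite_induct) (auto simp: subst_add mps_ring_sum)

text \<open>Continuity of substitution: in degree below \<open>n\<close>, a term is killed by the
  coefficient of \<open>f\<close> if |\<alpha>| < n, and by the order of g^\<alpha>
  otherwise.\<close>

lemma ord_ge_subst:
  assumes "ord_ge n f"
  shows "ord_ge n (mps_subst g f)"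
  unfolding ord_ge_def
proof (intro allI impI)
  fix \<gamma> :: "'u \<Rightarrow>\<^sub>0 nat" assume \<gamma>: "tdeg \<gamma> < n"
  have "mps_coeff f \<alpha> * mps_coeff (mps_pow g \<alpha>) \<gamma> = 0" for \<alpha>
    using assms coeff_pow_eq_0 [of \<gamma> \<alpha>] \<gamma> by (cases "tdeg \<alpha> < n") (auto simp: ord_ge_def)
  then show "mps_coeff (mps_subst g f) \<gamma> = 0"
    by (simp add: coeff_subst)
qed

lemma subst_term: "mps_subst g (mps_const c * mps_mono \<alpha>) = mps_const c * mps_pow g \<alpha>"
proof (rule mps_eqI)
  fix \<gamma>
  have "(\<lambda>\<alpha>'. c * mps_coeff (mps_mono \<alpha>) \<alpha>' * mps_coeff (mps_pow g \<alpha>') \<gamma>) =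
        (\<lambda>\<alpha>'. if \<alpha>' = \<alpha> then c * mps_coeff (mps_pow g \<alpha>) \<gamma> else 0)"
    by (auto simp: mps_coeff_mono)
  then show "mps_coeff (mps_subst g (mps_const c * mps_mono \<alpha>)) \<gamma> = mps_coeff (mps_const c * mps_pow g \<alpha>) \<gamma>"
    unfolding coeff_subst mps_coeff_const_mult by (simp only: Sum_any.delta)
qed

lemma subst_mono: "mps_subst g (mps_mono \<alpha>) = mps_pow g \<alpha>"
  using subst_term [of 1 \<alpha>] by simp

lemma subst_var: "mps_subst g (mps_var j) = g j"
  using subst_mono [of "Poly_Mapping.single j 1"] by (simp only: mps_mono_single mps_pow_single)

lemma subst_one: "mps_subst g 1 = 1"
  using subst_mono [of 0] by (simp add: mps_mono_0)

lemma subst_const: "mps_subst g (mps_const c) = mps_const c"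
  using subst_term [of c 0] by (simp add: mps_mono_0)

lemma subst_trunc:
  "mps_subst g (mps_trunc V n f) =
    (\<Sum>\<alpha> | Poly_Mapping.keys \<alpha> \<subseteq> V \<and> tdeg \<alpha> \<le> n. mps_const (mps_coeff f \<alpha>) * mps_pow g \<alpha>)"
  unfolding mps_trunc_def by (subst subst_sum) (auto simp: subst_term)

text \<open>For polynomials, multiplicativity follows by bilinearity from the law
  g^(\<alpha>+\<beta>) = g^\<alpha> g^\<beta>.\<close>

lemma subst_mult_trunc:
  "mps_subst g (mps_trunc V n f * mps_trunc V n h) =
    mps_subst g (mps_trunc V n f) * mps_subst g (mps_trunc V n h)"
proof -
  let ?S = "{\<alpha>. Poly_Mapping.keys \<alpha> \<subseteq> V \<and> tdeg \<alpha> \<le> n}"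
  have eq: "mps_const a * mps_mono \<alpha> * (mps_const b * mps_mono \<beta>) = mps_const (a * b) * mps_mono (\<alpha> + \<beta>)"
    for a b :: 'a and \<alpha> \<beta> :: "'v \<Rightarrow>\<^sub>0 nat"
    by (simp add: mps_const_mult mps_mono_add mult_ac)
  have in_R: "mps_const (mps_coeff f \<alpha> * mps_coeff h \<beta>) * mps_mono (\<alpha> + \<beta>) \<in> R"
    if "\<alpha> \<in> ?S" "\<beta> \<in> ?S" for \<alpha> \<beta>
    using that by (subst eq [symmetric]) auto
  have "mps_trunc V n f * mps_trunc V n h =
      (\<Sum>\<alpha>\<in>?S. \<Sum>\<beta>\<in>?S. mps_const (mps_coeff f \<alpha> * mps_coeff h \<beta>) * mps_mono (\<alpha> + \<beta>))"
    unfolding mps_trunc_def sum_product by (simp only: eq)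
  also have "mps_subst g \<dots> = (\<Sum>\<alpha>\<in>?S. mps_subst g
      (\<Sum>\<beta>\<in>?S. mps_const (mps_coeff f \<alpha> * mps_coeff h \<beta>) * mps_mono (\<alpha> + \<beta>)))"
    by (intro subst_sum mps_ring_sum in_R)
  also have "\<dots> = (\<Sum>\<alpha>\<in>?S. \<Sum>\<beta>\<in>?S. mps_const (mps_coeff f \<alpha> * mps_coeff h \<beta>) * mps_pow g (\<alpha> + \<beta>))"
    by (intro sum.cong refl) (subst subst_sum [OF in_R]; simp add: subst_term)
  also have "\<dots> = mps_subst g (mps_trunc V n f) * mps_subst g (mps_trunc V n h)"
    unfolding subst_trunc sum_product by (simp add: mps_const_mult mps_pow_add mult_ac)
  finally show ?thesis .
qed

text \<open>Replacing both factors by their truncations changes either side only in order at least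
  \<open>n\<close>, and for truncations the identity is known.\<close>

lemma subst_mult:
  assumes "f \<in> R" "h \<in> R"
  shows "mps_subst g (f * h) = mps_subst g f * mps_subst g h"
proof (rule mps_eq_if_ord_ge)
  fix n
  define p q where "p = mps_trunc V n f" and "q = mps_trunc V n h"
  have R: "p \<in> R" "q \<in> R" by (auto simp: p_def q_def)
  have ord: "ord_ge n (f - p)" "ord_ge n (h - q)"
    unfolding p_def q_def using assms finite_vars by (auto intro: ord_ge_diff_trunc)
  \<comment> \<open>Stated for an arbitrary index type because it serves both before and after the
    substitution.\<close>
  have split: "a * b - c * d = a * (b - d) + (a - c) * d" for a b c d :: "('w, 'a) mps"
    by (simp add: algebra_simps)
  have "ord_ge n (f * h - p * q)"
    unfolding split [of f h p q]
    by (intro ord_ge_add ord_ge_mult_left ord_ge_mult_right ord)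
  from ord_ge_subst [OF this]
  have 1: "ord_ge n (mps_subst g (f * h) - mps_subst g (p * q))"
    using assms R by (simp add: subst_diff mps_ring_mult)
  have "ord_ge n (mps_subst g f - mps_subst g p)" "ord_ge n (mps_subst g h - mps_subst g q)"
    using ord [THEN ord_ge_subst] assms R by (simp_all add: subst_diff)
  then have "ord_ge n (mps_subst g f * mps_subst g h - mps_subst g p * mps_subst g q)"
    unfolding split [of "mps_subst g f" "mps_subst g h" "mps_subst g p" "mps_subst g q"]
    by (intro ord_ge_add ord_ge_mult_left ord_ge_mult_right)
  from ord_ge_diff [OF 1 this] show "ord_ge n (mps_subst g (f * h) - mps_subst g f * mps_subst g h)"
    using subst_mult_trunc [of n f h] by (simp add: p_def q_def)
qed

lemma subst_prod:
  assumes "\<And>i. i \<in> S \<Longrightarrow> F i \<in> R"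
  shows "mps_subst g (prod F S) = (\<Prod>i\<in>S. mps_subst g (F i))"
  using assms
  by (induction S rule: infinite_finite_induct) (auto simp: subst_mult subst_one mps_ring_prod)

lemma subst_power: "f \<in> R \<Longrightarrow> mps_subst g (f ^ k) = mps_subst g f ^ k"
  by (induction k) (auto simp: subst_mult subst_one mps_ring_power)

lemma subst_in_ring:
  assumes "\<And>j. g j \<in> carrier (mps_ring W)"
  shows "mps_subst g f \<in> carrier (mps_ring W)"
proof -
  have pow: "mps_pow g \<alpha> \<in> carrier (mps_ring W)" for \<alpha>
    unfolding mps_pow_def using assms by auto
  have "Poly_Mapping.keys \<gamma> \<subseteq> W" if "mps_coeff (mps_subst g f) \<gamma> \<noteq> 0" for \<gamma>
  proof -
    from that obtain \<alpha> where "mps_coeff f \<alpha> * mps_coeff (mps_pow g \<alpha>) \<gamma> \<noteq> 0"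
      unfolding coeff_subst by (rule Sum_any.not_neutral_obtains_not_neutral)
    then have "mps_coeff (mps_pow g \<alpha>) \<gamma> \<noteq> 0" by auto
    with pow show ?thesis by (auto simp: carrier_mps_ring)
  qed
  then show ?thesis by (simp add: carrier_mps_ring)
qed

end

section \<open>Composition of substitutions and telescoping of monomials\<close>

text \<open>On a truncation the claim holds because substituting \<open>g\<close> respects sums and
  products. The remainder has order at least \<open>n\<close>, and all substitutions involved
  preserve that bound.\<close>

lemma subst_comp:
  assumes "mps_substitution V h" "mps_substitution W g"
    and h: "\<And>i. h i \<in> carrier (mps_ring W)" and f: "f \<in> carrier (mps_ring V)"
  shows "mps_subst g (mps_subst h f) = mps_subst (\<lambda>i. mps_subst g (h i)) f"
proof (rule mps_eq_if_ord_ge)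
  fix n
  interpret h: mps_substitution V h by fact
  interpret g: mps_substitution W g by fact
  let ?k = "\<lambda>i. mps_subst g (h i)"
  interpret k: mps_substitution V ?k
    by unfold_locales (use h.finite_vars h.ord_g g.ord_ge_subst in auto)
  define p where "p = mps_trunc V n f"
  have p: "p \<in> carrier (mps_ring V)" by (auto simp: p_def)
  have fp: "ord_ge n (f - p)"
    unfolding p_def using h.finite_vars f by (rule ord_ge_diff_trunc)
  have pow_in: "mps_pow h \<alpha> \<in> carrier (mps_ring W)" for \<alpha>
    unfolding mps_pow_def using h by auto
  have pow: "mps_subst g (mps_pow h \<alpha>) = mps_pow ?k \<alpha>" for \<alpha>
    unfolding mps_pow_def using h by (simp add: g.subst_prod g.subst_power mps_ring_power)
  have hp: "mps_subst g (mps_subst h p) = mps_subst ?k p"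
    unfolding p_def h.subst_trunc k.subst_trunc using pow_in
    by (simp add: g.subst_sum g.subst_mult g.subst_const pow mps_ring_mult mps_ring_const)
  have "ord_ge n (mps_subst g (mps_subst h (f - p)) - mps_subst ?k (f - p))"
    by (intro ord_ge_diff g.ord_ge_subst h.ord_ge_subst k.ord_ge_subst fp)
  also have "mps_subst g (mps_subst h (f - p)) - mps_subst ?k (f - p) =
      mps_subst g (mps_subst h f) - mps_subst ?k f"
    using f p h by (simp add: h.subst_diff k.subst_diff g.subst_diff h.subst_in_ring hp)
  finally show "ord_ge n (mps_subst g (mps_subst h f) - mps_subst ?k f)" .
qed

text \<open>Only the values of \<open>g\<close> on \<open>V\<close> matter, since exponents with
  other variables have coefficient 0 in \<open>f\<close>. For \<Phi> \<circ> \<Psi> these are the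
  indices below \<open>m\<close>.\<close>

lemma subst_eq_self:
  assumes "\<And>j. j \<in> V \<Longrightarrow> g j = mps_var j" and f: "f \<in> carrier (mps_ring V)"
  shows "mps_subst g f = f"
proof (rule mps_eqI)
  fix \<gamma>
  have "(\<lambda>\<alpha>. mps_coeff f \<alpha> * mps_coeff (mps_pow g \<alpha>) \<gamma>) =
      (\<lambda>\<alpha>. if \<alpha> = \<gamma> then mps_coeff f \<gamma> else 0)"
  proof
    fix \<alpha>
    show "mps_coeff f \<alpha> * mps_coeff (mps_pow g \<alpha>) \<gamma> = (if \<alpha> = \<gamma> then mps_coeff f \<gamma> else 0)"
    proof (cases "Poly_Mapping.keys \<alpha> \<subseteq> V")
      case True
      then have "mps_pow g \<alpha> = mps_pow mps_var \<alpha>"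
        unfolding mps_pow_def using assms(1) by (intro prod.cong) auto
      then show ?thesis by (auto simp: mps_pow_var mps_coeff_mono)
    next
      case False
      with f have "mps_coeff f \<alpha> = 0" by (auto simp: carrier_mps_ring)
      then show ?thesis by auto
    qed
  qed
  then show "mps_coeff (mps_subst g f) \<gamma> = mps_coeff f \<gamma>"
    unfolding mps_subst_def mps_pow_def mps_coeff_Abs by (simp only: Sum_any.delta)
qed

text \<open>The order of the cofactors is recorded so that they can be summed over all \<open>\<alpha>\<close>.\<close>

lemma mono_diff_pow:
  fixes g :: "'v::finite \<Rightarrow> ('v, 'a::comm_ring_1) mps"
  assumes g: "\<And>j. ord_ge 1 (g j)"
  shows "\<exists>q. (\<forall>j. ord_ge (tdeg \<alpha> - 1) (q j)) \<and>
             mps_mono \<alpha> - mps_pow g \<alpha> = (\<Sum>j\<in>UNIV. (mps_var j - g j) * q j)"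
proof (induction \<alpha> rule: tdeg_induct)
  case zero
  then show ?case by (intro exI [of _ "\<lambda>_. 0"]) (simp add: mps_mono_0)
next
  case (add_single \<beta> i)
  then obtain q where q: "\<And>j. ord_ge (tdeg \<beta> - 1) (q j)"
    and eq: "mps_mono \<beta> - mps_pow g \<beta> = (\<Sum>j\<in>UNIV. (mps_var j - g j) * q j)" by blast
  define \<alpha> where "\<alpha> = \<beta> + Poly_Mapping.single i 1"
  have deg: "tdeg \<alpha> = tdeg \<beta> + 1" by (simp only: \<alpha>_def tdeg_add tdeg_single)
  \<comment> \<open>From t^\<alpha> - g^\<alpha> = (t^\<beta> - g^\<beta>) t_i + (t_i - g_i)
    g^\<beta>: the first summand multiplies all old cofactors by t_i, the second adds g^\<beta> to
    the cofactor of index \<open>i\<close>.\<close>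
  define q' where "q' j = q j * mps_var i + (if j = i then mps_pow g \<beta> else 0)" for j
  have "ord_ge (tdeg \<alpha> - 1) (q' j)" for j
  proof -
    have "ord_ge (tdeg \<alpha> - 1) (q j * mps_var i)"
      by (rule ord_ge_mono [OF ord_ge_mult [OF q ord_ge_1_var]]) (simp add: deg)
    with ord_ge_pow [of g \<beta>, OF g] show ?thesis
      by (auto simp: q'_def deg intro: ord_ge_add)
  qed
  moreover have "mps_mono \<alpha> - mps_pow g \<alpha> = (\<Sum>j\<in>UNIV. (mps_var j - g j) * q' j)"
  proof -
    have "mps_mono \<alpha> - mps_pow g \<alpha> =
        (mps_mono \<beta> - mps_pow g \<beta>) * mps_var i + (mps_var i - g i) * mps_pow g \<beta>"
      unfolding \<alpha>_def mps_mono_add mps_pow_add mps_mono_single mps_pow_single by (simp add: algebra_simps)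
    also have "\<dots> = (\<Sum>j\<in>UNIV. (mps_var j - g j) * (q j * mps_var i)) +
        (\<Sum>j\<in>UNIV. if j = i then (mps_var i - g i) * mps_pow g \<beta> else 0)"
      unfolding eq by (simp add: sum_distrib_right mult.assoc)
    also have "\<dots> = (\<Sum>j\<in>UNIV. (mps_var j - g j) * q' j)"
      unfolding sum.distrib [symmetric] q'_def by (rule sum.cong) (auto simp: distrib_left)
    finally show ?thesis .
  qed
  ultimately show ?case unfolding \<alpha>_def by blast
qed

text \<open>The cofactors of the single monomials are added up with the coefficients of
  \<open>f\<close> as weights. The infinite sum converges coefficientwise because the order of the
  cofactors grows with |\<alpha>|.\<close>

lemma diff_subst_combination:
  fixes g :: "'v::finite \<Rightarrow> ('v, 'a::comm_ring_1) mps"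
  assumes g: "\<And>j. ord_ge 1 (g j)"
  shows "\<exists>Q. f - mps_subst g f = (\<Sum>j\<in>UNIV. (mps_var j - g j) * Q j)"
proof -
  interpret mps_substitution UNIV g by unfold_locales (use g in simp_all)
  obtain q where q: "\<And>\<alpha> j. ord_ge (tdeg \<alpha> - 1) (q \<alpha> j)"
    and eq: "\<And>\<alpha>. mps_mono \<alpha> - mps_pow g \<alpha> = (\<Sum>j\<in>UNIV. (mps_var j - g j) * q \<alpha> j)"
    using mono_diff_pow [of g, OF g] by metis
  let ?S = "\<lambda>n. {\<alpha>::'v \<Rightarrow>\<^sub>0 nat. tdeg \<alpha> \<le> n}"
  have fin: "finite (?S n)" for n
    using finite_tdeg_le [of "UNIV :: 'v set" n] by simp
  \<comment> \<open>A cofactor for \<alpha> has order at least |\<alpha>| - 1, so it reaches the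
    exponent \<gamma> only if |\<alpha>| \<le> |\<gamma>| + 1; hence the \<open>Suc\<close>.\<close>
  define Q where "Q j = Abs_mps (\<lambda>\<gamma>. \<Sum>\<alpha>\<in>?S (Suc (tdeg \<gamma>)). mps_coeff f \<alpha> * mps_coeff (q \<alpha> j) \<gamma>)" for j
  define Qn where "Qn n j = (\<Sum>\<alpha>\<in>?S n. mps_const (mps_coeff f \<alpha>) * q \<alpha> j)" for n j
  have Qn: "ord_ge n (Q j - Qn n j)" for n j
    unfolding ord_ge_def
  proof (intro allI impI)
    fix \<gamma> :: "'v \<Rightarrow>\<^sub>0 nat" assume \<gamma>: "tdeg \<gamma> < n"
    have "mps_coeff (q \<alpha> j) \<gamma> = 0" if "Suc (tdeg \<gamma>) < tdeg \<alpha>" for \<alpha>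
      using q [of \<alpha> j] that by (auto simp: ord_ge_def)
    then have "(\<Sum>\<alpha>\<in>?S (Suc (tdeg \<gamma>)). mps_coeff f \<alpha> * mps_coeff (q \<alpha> j) \<gamma>) =
        (\<Sum>\<alpha>\<in>?S n. mps_coeff f \<alpha> * mps_coeff (q \<alpha> j) \<gamma>)"
      using \<gamma> fin by (intro sum.mono_neutral_left) auto
    then show "mps_coeff (Q j - Qn n j) \<gamma> = 0"
      by (simp add: Q_def Qn_def mps_coeff_sum)
  qed
  have "f - mps_subst g f = (\<Sum>j\<in>UNIV. (mps_var j - g j) * Q j)"
  proof (rule mps_eq_if_ord_ge)
    fix n
    define p where "p = mps_trunc UNIV n f"
    have "p - mps_subst g p = (\<Sum>\<alpha>\<in>?S n. mps_const (mps_coeff f \<alpha>) * (mps_mono \<alpha> - mps_pow g \<alpha>))"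
      unfolding p_def subst_trunc by (simp add: mps_trunc_def algebra_simps sum_subtractf)
    also have "\<dots> = (\<Sum>\<alpha>\<in>?S n. \<Sum>j\<in>UNIV. (mps_var j - g j) * (mps_const (mps_coeff f \<alpha>) * q \<alpha> j))"
      unfolding eq by (simp add: sum_distrib_left mult_ac)
    also have "\<dots> = (\<Sum>j\<in>UNIV. (mps_var j - g j) * Qn n j)"
      unfolding Qn_def sum_distrib_left by (rule sum.swap)
    finally have p: "p - mps_subst g p = (\<Sum>j\<in>UNIV. (mps_var j - g j) * Qn n j)" .
    have fp: "ord_ge n (f - p)"
      unfolding p_def by (rule ord_ge_diff_trunc) auto
    \<comment> \<open>All three parts have order at least \<open>n\<close>. Removing the exact
      identity for the truncation \<open>p\<close> leaves the desired identity for \<open>f\<close>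
      up to order \<open>n\<close>.\<close>
    have "ord_ge n ((f - p) - mps_subst g (f - p) - (\<Sum>j\<in>UNIV. (mps_var j - g j) * (Q j - Qn n j)))"
      by (intro ord_ge_diff ord_ge_sum ord_ge_mult_left ord_ge_subst fp Qn)
    also have "(f - p) - mps_subst g (f - p) - (\<Sum>j\<in>UNIV. (mps_var j - g j) * (Q j - Qn n j)) =
        f - mps_subst g f - (\<Sum>j\<in>UNIV. (mps_var j - g j) * Q j)
        - (p - mps_subst g p - (\<Sum>j\<in>UNIV. (mps_var j - g j) * Qn n j))"
      by (simp add: subst_diff right_diff_distrib sum_subtractf)
    finally show "ord_ge n (f - mps_subst g f - (\<Sum>j\<in>UNIV. (mps_var j - g j) * Q j))"
      by (simp add: p)
  qed
  then show ?thesis by blast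
qed

section \<open>The substitution \<open>t = B s\<close>\<close>

text \<open>One inclusion holds because the preimage of an ideal is an ideal. The other needs the
  image to be an ideal, which is where surjectivity enters.\<close>

lemma (in ring_hom_ring) image_genideal:
  assumes surj: "h ` carrier R = carrier S" and G: "G \<subseteq> carrier R"
  shows "h ` genideal R G = genideal S (h ` G)"
proof
  have hG: "h ` G \<subseteq> carrier S" using G by auto
  have "genideal R G \<subseteq> {r \<in> carrier R. h r \<in> genideal S (h ` G)}"
    by (intro R.genideal_minimal ideal_vimage S.genideal_ideal hG)
       (use G S.genideal_self [OF hG] in auto)
  then show "h ` genideal R G \<subseteq> genideal S (h ` G)" by auto
  interpret I: ideal "genideal R G" R by (rule R.genideal_ideal [OF G])
  have "ideal (h ` genideal R G) S"
  proof (rule idealI)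
    show "ring S" ..
    show "subgroup (h ` genideal R G) (add_monoid S)"
      using group_hom.subgroup_img_is_subgroup [OF a_group_hom I.a_subgroup] by simp
  next
    fix a x assume a: "a \<in> h ` genideal R G" and x: "x \<in> carrier S"
    from x obtain r where r: "r \<in> carrier R" "x = h r" using surj by blast
    from a obtain i where i: "i \<in> genideal R G" "a = h i" by blast
    show "x \<otimes>\<^bsub>S\<^esub> a \<in> h ` genideal R G"
      using r i I.I_l_closed [of i r] I.Icarr [of i] by (force simp flip: hom_mult)
    show "a \<otimes>\<^bsub>S\<^esub> x \<in> h ` genideal R G"
      using r i I.I_r_closed [of i r] I.Icarr [of i] by (force simp flip: hom_mult)
  qed
  then show "genideal S (h ` G) \<subseteq> h ` genideal R G"
    by (rule S.genideal_minimal) (use R.genideal_self [OF G] in auto)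
qed

section \<open>Linear algebra: a left inverse of \<open>B\<close>\<close>

text \<open>Here \<open>c\<close> is a left inverse C of B, and \<open>Y\<close> witnesses 1 - BC =
  YA. Such a factorization exists because 1 - BC kills the columns of B, which span the kernel of
  A.\<close>

lemma kernel_basis_dual:
  fixes A :: "int ^ 'n ^ 'd"
  assumes "kernel_basis A m b"
  obtains c :: "nat \<Rightarrow> 'n \<Rightarrow> complex" and Y :: "complex ^ 'd ^ 'n" where
    "\<And>k i. i < m \<Longrightarrow> (\<Sum>j\<in>UNIV. c k j * b i $ j) = (if i = k then 1 else 0)"
    "\<And>j l. (if j = l then 1 else 0) - (\<Sum>k<m. b k $ j * c k l) = (\<Sum>i\<in>UNIV. Y $ j $ i * of_int (A $ i $ l))"
proof -
  let ?A = "map_matrix of_int A :: complex ^ 'n ^ 'd"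
  have inj: "inj_on b {..<m}" and indep: "vec.independent (b ` {..<m})"
    and span: "vec.span (b ` {..<m}) = {x. ?A *v x = 0}"
    using assms by (auto simp: kernel_basis_def complex_kernel_def)
  \<comment> \<open>The dual basis, extended linearly to the whole space. Its values are vectors:
    the scalar 1 is represented by the all-ones vector.\<close>
  have "\<exists>f. Vector_Spaces.linear (*s) (*s) f \<and> (\<forall>x\<in>b ` {..<m}. f x = (if x = b k then 1 else 0 :: complex ^ 'n))" for k
    by (rule vec.linear_independent_extend [OF indep])
  then obtain f where f: "\<And>k. Vector_Spaces.linear (*s) (*s) (f k)"
    and fb: "\<And>k x. x \<in> b ` {..<m} \<Longrightarrow> f k x = (if x = b k then 1 else 0 :: complex ^ 'n)"
    by metis
  \<comment> \<open>On the basis each \<open>f k\<close> yields the all-ones vector or 0, so any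
    coordinate reads off the scalar.\<close>
  define u where "u = (undefined :: 'n)"
  \<comment> \<open>The default 0 makes the duality relation hold for \<open>k \<ge> m\<close> as
    well, where \<open>i < m\<close> forces \<open>i \<noteq> k\<close>.\<close>
  define c where "c k j = (if k < m then matrix (f k) $ u $ j else 0)" for k j
  have c: "(\<Sum>j\<in>UNIV. c k j * b i $ j) = (if i = k then 1 else 0)" if "i < m" for i k
  proof (cases "k < m")
    case True
    then have "(\<Sum>j\<in>UNIV. c k j * b i $ j) = (matrix (f k) *v b i) $ u"
      by (simp add: c_def matrix_vector_mult_def)
    also have "\<dots> = f k (b i) $ u" using matrix_works [OF f] by simp
    also have "\<dots> = (if i = k then 1 else 0)"
      using that True inj by (simp add: fb inj_on_eq_iff)
    finally show ?thesis .
  qed (use that in \<open>simp add: c_def\<close>)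
  define E :: "complex ^ 'n ^ 'n" where
    "E = (\<chi> j l. (if j = l then 1 else 0) - (\<Sum>k<m. b k $ j * c k l))"
  have Eb: "E *v b i = 0" if i: "i < m" for i
  proof (rule vec_eq_iff [THEN iffD2], rule allI)
    fix j
    have "(E *v b i) $ j = (\<Sum>l\<in>UNIV. (if j = l then 1 else 0) * b i $ l) - (\<Sum>l\<in>UNIV. \<Sum>k<m. b k $ j * (c k l * b i $ l))"
      by (simp add: matrix_vector_mult_def E_def left_diff_distrib sum_subtractf sum_distrib_right mult.assoc)
    also have "(\<Sum>l\<in>UNIV. \<Sum>k<m. b k $ j * (c k l * b i $ l)) = (\<Sum>k<m. b k $ j * (if i = k then 1 else 0))"
      by (subst sum.swap) (simp add: c [OF i] flip: sum_distrib_left)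
    also have "\<dots> = (\<Sum>k<m. if k = i then b k $ j else 0)"
      by (rule sum.cong) auto
    also have "\<dots> = b i $ j" using i by simp
    also have "(\<Sum>l\<in>UNIV. (if j = l then 1 else 0) * b i $ l) = (\<Sum>l\<in>UNIV. if l = j then b i $ l else 0)"
      by (rule sum.cong) auto
    also have "\<dots> = b i $ j" by simp
    finally show "(E *v b i) $ j = 0 $ j" by simp
  qed
  have E: "E *v x = 0" if "?A *v x = 0" for x
  proof -
    from that have "x \<in> vec.span (b ` {..<m})" using span by simp
    then show ?thesis
      by (rule vec.linear_eq_0_on_span [OF matrix_vector_mul_linear_gen, rotated]) (use Eb in auto)
  qed
  \<comment> \<open>A generalized inverse of A: a linear right inverse on the image of A, so that A
    g A = A.\<close>
  obtain g where g: "Vector_Spaces.linear (*s) (*s) g" "\<And>x. ?A *v (g (?A *v x)) = ?A *v x"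
    using vec.linear_exists_right_inverse_on [OF matrix_vector_mul_linear_gen [of ?A] vec.subspace_UNIV]
    by auto
  \<comment> \<open>The vector x - g(Ax) lies in the kernel of A, hence E x = E g(Ax). This gives Y
    = E g.\<close>
  have E_factor: "E = E ** matrix g ** ?A"
  proof (rule matrix_eq [THEN iffD2], rule allI)
    fix x
    have "?A *v (x - g (?A *v x)) = 0"
      by (simp add: matrix_vector_mult_diff_distrib g(2))
    then have "E *v (x - g (?A *v x)) = 0" by (rule E)
    then show "E *v x = (E ** matrix g ** ?A) *v x"
      by (simp add: matrix_vector_mult_diff_distrib matrix_works [OF g(1)] flip: matrix_vector_mul_assoc)
  qed
  have EY: "E $ j $ l = (\<Sum>i\<in>UNIV. (E ** matrix g) $ j $ i * of_int (A $ i $ l))" for j l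
    using arg_cong [OF E_factor, of "\<lambda>M. M $ j $ l"]
    by (simp add: matrix_matrix_mult_def [of "E ** matrix g"] map_matrix_def)
  have "(if j = l then 1 else 0) - (\<Sum>k<m. b k $ j * c k l) =
      (\<Sum>i\<in>UNIV. (E ** matrix g) $ j $ i * of_int (A $ i $ l))" for j l
    by (rule trans [OF _ EY]) (simp add: E_def)
  with c show ?thesis by (rule that)
qed

section \<open>\<Phi> as a ring homomorphism, its kernel and its image\<close>

lemma ord_ge_linear_form: "ord_ge 1 (\<Sum>j\<in>S. mps_const (a j) * mps_var j)"
  by (intro ord_ge_sum ord_ge_mult_left ord_ge_1_var)

lemma Bs_in_ring: "Bs m b j \<in> carrier (s_ring m)"
  unfolding Bs_def by auto

lemma Phi_substitution: "mps_substitution UNIV (Bs m b :: 'n::finite \<Rightarrow> _)"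
  by unfold_locales (simp_all only: finite Bs_def ord_ge_linear_form)

lemma Phi_hom: "ring_hom_ring t_ring (s_ring m) (Phi m (b :: nat \<Rightarrow> complex ^ 'n))"
proof -
  interpret mps_substitution "UNIV :: 'n set" "Bs m b" by (rule Phi_substitution)
  show ?thesis
    by (rule ring_hom_ringI)
       (auto simp: Phi_def subst_mult subst_add subst_one subst_in_ring Bs_in_ring
         intro: cring.axioms(1) mps_ring_cring)
qed

lemma At_ideal_is_ideal: "ideal (At_ideal A) t_ring"
  unfolding At_ideal_def by (intro ring.genideal_ideal cring.axioms(1) mps_ring_cring) simp

lemma t_ideal_closed:
  assumes "ideal I t_ring"
  shows "0 \<in> I"
    and "f \<in> I \<Longrightarrow> g \<in> I \<Longrightarrow> f + g \<in> I"
    and "f \<in> I \<Longrightarrow> g \<in> I \<Longrightarrow> f - g \<in> I"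
    and "f \<in> I \<Longrightarrow> h * f \<in> I"
proof -
  interpret ideal I t_ring by fact
  show add: "f + g \<in> I" if "f \<in> I" "g \<in> I" for f g using additive_subgroup.a_closed [OF is_additive_subgroup that] by simp
  show mult: "h * f \<in> I" if "f \<in> I" for h f using I_l_closed [of f h] that by simp
  show "0 \<in> I" using additive_subgroup.zero_closed [OF is_additive_subgroup] by simp
  show "f - g \<in> I" if "f \<in> I" "g \<in> I" using add [OF that(1) mult [OF that(2), of "- 1"]] by simp
qed

lemma t_ideal_sum:
  assumes "ideal I t_ring" "\<And>i. i \<in> S \<Longrightarrow> F i \<in> I"
  shows "sum F S \<in> I"
  using assms(2) by (induction S rule: infinite_finite_induct) (auto intro: t_ideal_closed [OF assms(1)])

text \<open>The columns of B lie in the kernel of A, so AB = 0 and \<Phi> kills every row of At. The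
  preimage of the zero ideal then contains the ideal they generate.\<close>

lemma At_ideal_subset_kernel:
  fixes A :: "int ^ 'n ^ 'd"
  assumes "kernel_basis A m b" "f \<in> At_ideal A"
  shows "Phi m b f = 0"
proof -
  interpret mps_substitution "UNIV :: 'n set" "Bs m b" by (rule Phi_substitution)
  interpret ring_hom_ring "t_ring :: ('n, complex) mps ring" "s_ring m" "Phi m b" by (rule Phi_hom)
  have zero: "ideal {0} (s_ring m)"
    using S.zeroideal by simp
  have "Phi m b (\<Sum>j\<in>UNIV. mps_const (of_int (A $ i $ j)) * mps_var j) = 0" for i
  proof -
    have b: "(\<Sum>j\<in>UNIV. of_int (A $ i $ j) * b k $ j) = 0" if "k < m" for k
    proof -
      have "b k \<in> complex_kernel A"
        using assms(1) that vec.span_base [of "b k" "b ` {..<m}"] by (auto simp: kernel_basis_def)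
      then have "(map_matrix of_int A *v b k) $ i = 0" by (simp add: complex_kernel_def)
      then show ?thesis by (simp add: matrix_vector_mult_def map_matrix_def)
    qed
    have "Phi m b (\<Sum>j\<in>UNIV. mps_const (of_int (A $ i $ j)) * mps_var j) =
        (\<Sum>j\<in>UNIV. \<Sum>k<m. mps_const (of_int (A $ i $ j) * b k $ j) * mps_var k)"
      by (simp add: Phi_def subst_sum subst_mult subst_const subst_var Bs_def sum_distrib_left mps_const_mult mult.assoc)
    also have "\<dots> = (\<Sum>k<m. mps_const (\<Sum>j\<in>UNIV. of_int (A $ i $ j) * b k $ j) * mps_var k)"
      by (subst sum.swap) (simp add: mps_const_sum sum_distrib_right)
    also have "\<dots> = 0" by (simp add: b)
    finally show ?thesis .
  qed
  then have "At_ideal A \<subseteq> {r \<in> carrier t_ring. Phi m b r \<in> {0}}"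
    unfolding At_ideal_def by (intro R.genideal_minimal ideal_vimage zero) auto
  with assms(2) show ?thesis by blast
qed

lemma Phi_surj_kernel:
  fixes A :: "int ^ 'n ^ 'd"
  assumes "kernel_basis A m b"
  shows "Phi m b ` UNIV = carrier (s_ring m)"
    and "Phi m b f = 0 \<Longrightarrow> f \<in> At_ideal A"
proof -
  obtain c :: "nat \<Rightarrow> 'n \<Rightarrow> complex" and Y where
    c: "\<And>k i. i < m \<Longrightarrow> (\<Sum>j\<in>UNIV. c k j * b i $ j) = (if i = k then 1 else 0)" and
    Y: "\<And>j l. (if j = l then 1 else 0) - (\<Sum>k<m. b k $ j * c k l) = (\<Sum>i\<in>UNIV. Y $ j $ i * of_int (A $ i $ l))"
    using kernel_basis_dual [OF assms] by blast
  \<comment> \<open>The entries of the vector Ct; substituting them for \<open>s\<close> is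
    \<Psi>.\<close>
  define L :: "nat \<Rightarrow> ('n, complex) mps" where
    "L k = (\<Sum>j\<in>UNIV. mps_const (c k j) * mps_var j)" for k
  have Phi: "mps_substitution (UNIV :: 'n set) (Bs m b)" by (rule Phi_substitution)
  then interpret Phi: mps_substitution "UNIV :: 'n set" "Bs m b" .
  have Psi: "mps_substitution {..<m} L"
    by unfold_locales (simp_all only: finite_lessThan L_def ord_ge_linear_form)
  then interpret Psi: mps_substitution "{..<m}" L .
  \<comment> \<open>The relation CB = 1 in terms of series.\<close>
  have Phi_L: "mps_subst (Bs m b) (L k) = mps_var k" if "k < m" for k
  proof -
    have "mps_subst (Bs m b) (L k) = (\<Sum>j\<in>UNIV. \<Sum>i<m. mps_const (c k j * b i $ j) * mps_var i)"
      by (simp add: L_def Phi.subst_sum Phi.subst_mult Phi.subst_const Phi.subst_var Bs_def sum_distrib_left mps_const_mult mult.assoc)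
    also have "\<dots> = (\<Sum>i<m. mps_const (\<Sum>j\<in>UNIV. c k j * b i $ j) * mps_var i)"
      by (subst sum.swap) (simp add: mps_const_sum sum_distrib_right)
    also have "\<dots> = (\<Sum>i<m. if i = k then mps_var i else 0)"
      by (rule sum.cong) (auto simp: c)
    also have "\<dots> = mps_var k" using that by simp
    finally show ?thesis .
  qed
  have "Phi m b (mps_subst L h) = h" if "h \<in> carrier (s_ring m)" for h
  proof -
    have "Phi m b (mps_subst L h) = mps_subst (\<lambda>i. mps_subst (Bs m b) (L i)) h"
      unfolding Phi_def using that by (simp add: subst_comp [OF Psi Phi])
    also have "\<dots> = h"
      using that Phi_L by (intro subst_eq_self [of "{..<m}"]) auto
    finally show ?thesis .
  qed
  then have "carrier (s_ring m) \<subseteq> Phi m b ` UNIV" by (metis rangeI subsetI)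
  moreover have "Phi m b ` UNIV \<subseteq> carrier (s_ring m)"
    unfolding Phi_def using Phi.subst_in_ring [of "{..<m}"] Bs_in_ring by blast
  ultimately show "Phi m b ` UNIV = carrier (s_ring m)" by blast
  \<comment> \<open>Applying \<Psi> to (Bs)_j gives (BCt)_j.\<close>
  have Psi_B: "mps_subst L (Bs m b j) = (\<Sum>l\<in>UNIV. mps_const (\<Sum>k<m. b k $ j * c k l) * mps_var l)" for j
  proof -
    have "mps_subst L (Bs m b j) = (\<Sum>k<m. mps_const (b k $ j) * L k)"
      unfolding Bs_def
      by (subst Psi.subst_sum) (auto simp: Psi.subst_mult Psi.subst_const Psi.subst_var mps_ring_const mps_ring_var)
    also have "\<dots> = (\<Sum>k<m. \<Sum>l\<in>UNIV. mps_const (b k $ j * c k l) * mps_var l)"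
      by (simp add: L_def sum_distrib_left mps_const_mult mult.assoc)
    also have "\<dots> = (\<Sum>l\<in>UNIV. mps_const (\<Sum>k<m. b k $ j * c k l) * mps_var l)"
      by (subst sum.swap) (simp add: mps_const_sum sum_distrib_right)
    finally show ?thesis .
  qed
  \<comment> \<open>The coefficients of t_j - (BCt)_j form row \<open>j\<close> of 1 - BC = YA, so
    this form combines the rows of At with the constants Y_ji.\<close>
  have At: "mps_var j - mps_subst L (Bs m b j) \<in> At_ideal A" for j
  proof -
    have "mps_var j = (\<Sum>l\<in>UNIV. if l = j then mps_var l else 0 :: ('n, complex) mps)" by simp
    also have "\<dots> = (\<Sum>l\<in>UNIV. mps_const (if j = l then 1 else 0) * mps_var l)"
      by (rule sum.cong) auto
    finally have "mps_var j - mps_subst L (Bs m b j) =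
        (\<Sum>l\<in>UNIV. mps_const ((if j = l then 1 else 0) - (\<Sum>k<m. b k $ j * c k l)) * mps_var l)"
      by (simp only: Psi_B mps_const_diff left_diff_distrib sum_subtractf)
    also have "\<dots> = (\<Sum>l\<in>UNIV. \<Sum>i\<in>UNIV. mps_const (Y $ j $ i) * (mps_const (of_int (A $ i $ l)) * mps_var l))"
      by (simp only: Y mps_const_sum mps_const_mult sum_distrib_right mult.assoc)
    also have "\<dots> = (\<Sum>i\<in>UNIV. mps_const (Y $ j $ i) * (\<Sum>l\<in>UNIV. mps_const (of_int (A $ i $ l)) * mps_var l))"
      by (subst sum.swap) (simp only: sum_distrib_left)
    also have "\<dots> \<in> At_ideal A"
    proof (rule t_ideal_sum [OF At_ideal_is_ideal], rule t_ideal_closed(4) [OF At_ideal_is_ideal])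
      fix i
      show "(\<Sum>l\<in>UNIV. mps_const (of_int (A $ i $ l)) * mps_var l) \<in> At_ideal A"
        unfolding At_ideal_def
        by (rule subsetD [OF ring.genideal_self]) (auto intro: cring.axioms(1) mps_ring_cring)
    qed
    finally show ?thesis .
  qed
  \<comment> \<open>Now \<Psi>(\<Phi>(f)) = 0, so telescoping with g_j = (BCt)_j expresses
    \<open>f\<close> itself through the forms just treated.\<close>
  assume "Phi m b f = 0"
  then have "f - mps_subst L (mps_subst (Bs m b) f) = f" by (simp add: Phi_def)
  then have "f - mps_subst (\<lambda>j. mps_subst L (Bs m b j)) f = f"
    by (simp add: subst_comp [OF Phi Psi] Bs_in_ring)
  moreover obtain Q where "f - mps_subst (\<lambda>j. mps_subst L (Bs m b j)) f =
      (\<Sum>j\<in>UNIV. (mps_var j - mps_subst L (Bs m b j)) * Q j)"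
    using diff_subst_combination [of "\<lambda>j. mps_subst L (Bs m b j)" f] Psi.ord_ge_subst Phi.ord_g by blast
  ultimately have "f = (\<Sum>j\<in>UNIV. Q j * (mps_var j - mps_subst L (Bs m b j)))"
    by (simp add: mult.commute)
  also have "\<dots> \<in> At_ideal A"
    by (intro t_ideal_sum t_ideal_closed(4) At_ideal_is_ideal At)
  finally show "f \<in> At_ideal A" .
qed

section \<open>Monomial ideals under \<Phi>\<close>

lemma Phi_t_monom:
  fixes b :: "nat \<Rightarrow> complex ^ 'n"
  shows "Phi m b (t_monom S) = Bs_monom m b S"
proof -
  interpret mps_substitution "UNIV :: 'n set" "Bs m b" by (rule Phi_substitution)
  show ?thesis by (simp add: Phi_def t_monom_def Bs_monom_def subst_prod subst_var)
qed

text \<open>Generators go to generators, and surjectivity of \<Phi> turns this into equality of the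
  ideals.\<close>

lemma Phi_P_hat:
  assumes "kernel_basis A m b"
  shows "Phi m b ` P_hat A v N = P_intr A v m b N"
proof -
  have "Phi m b ` P_hat A v N = genideal (s_ring m)
      (Phi m b ` {t_monom ((I \<union> J) - \<Inter>N) | I J. I \<in> N \<and> J \<in> NS A v - N})"
    unfolding P_hat_def
    by (rule ring_hom_ring.image_genideal [OF Phi_hom]) (simp_all add: Phi_surj_kernel [OF assms])
  also have "Phi m b ` {t_monom ((I \<union> J) - \<Inter>N) | I J. I \<in> N \<and> J \<in> NS A v - N} =
      {Bs_monom m b ((I \<union> J) - \<Inter>N) | I J. I \<in> N \<and> J \<in> NS A v - N}"
    by (auto simp: image_def simp flip: Phi_t_monom)
  finally show ?thesis by (simp add: P_intr_def)
qed

lemma t_monom_union_disjoint: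
  fixes S T :: "'n::finite set"
  shows "S \<inter> T = {} \<Longrightarrow> t_monom (S \<union> T) = t_monom S * t_monom T"
  unfolding t_monom_def by (rule prod.union_disjoint) auto

lemma M_hat_is_ideal: "ideal (M_hat N) t_ring"
  unfolding M_hat_def by (intro ring.genideal_ideal cring.axioms(1) mps_ring_cring) simp

lemma t_monom_in_M_hat: "I \<in> N \<Longrightarrow> t_monom (I - \<Inter>N) \<in> M_hat N"
  unfolding M_hat_def
  by (rule subsetD [OF ring.genideal_self]) (auto intro: cring.axioms(1) mps_ring_cring)

text \<open>Each generator of \<open>P_hat\<close> is the generator of \<open>M_hat\<close>
  belonging to \<open>I\<close>, multiplied by the variables of \<open>J - I\<close> outside
  \<open>\<Inter>N\<close>.\<close>

lemma P_hat_subset_M_hat: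
  fixes v :: "complex ^ 'n"
  shows "P_hat A v N \<subseteq> M_hat N"
  unfolding P_hat_def
proof (rule ring.genideal_minimal [OF cring.axioms(1) [OF mps_ring_cring] M_hat_is_ideal], clarify)
  fix I J assume "I \<in> N"
  have "(I \<union> J) - \<Inter>N = (J - I - \<Inter>N) \<union> (I - \<Inter>N)" by auto
  then have "t_monom ((I \<union> J) - \<Inter>N) = t_monom (J - I - \<Inter>N) * (t_monom (I - \<Inter>N) :: ('n, complex) mps)"
    by (simp only:) (rule t_monom_union_disjoint, auto)
  with t_ideal_closed(4) [OF M_hat_is_ideal t_monom_in_M_hat [OF \<open>I \<in> N\<close>]]
  show "t_monom ((I \<union> J) - \<Inter>N) \<in> M_hat N" by simp
qed

section \<open>Comparison of the two colon ideals\<close>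

theorem proposition6p6:
  fixes A :: "int ^ 'n ^ 'd"
    and \<beta> :: "complex ^ 'd"
    and w :: "real ^ 'n"
    and v0 :: "complex ^ 'n"
    and b :: "nat \<Rightarrow> complex ^ 'n"
    and N :: "'n set set"
    and m :: nat
  assumes "rank (map_matrix of_int A :: rat ^ 'n ^ 'd) = CARD('d)"
    and "\<exists>(h :: rat ^ 'd) c. h \<noteq> 0 \<and> c \<noteq> 0 \<and>
           (\<forall>j. (\<Sum>i\<in>UNIV. h $ i * of_int (A $ i $ j)) = c)"
    and "monomial_ideal (initial_ideal w (toric_ideal A))"
    and "fake_exponent A \<beta> w v0"
    and "m = CARD('n) - CARD('d)"
    and "kernel_basis A m b"
    and "neg_supp_family A w v0 N"
    and "ordered_family A v0 N"
    and "colon_ideal t_ring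
           ((At_ideal A \<cdot>\<^bsub>t_ring\<^esub> M_hat N) <+>\<^bsub>t_ring\<^esub> P_hat A v0 N) (m_hat v0 N) =
         colon_ideal t_ring
           ((At_ideal A \<inter> M_hat N) <+>\<^bsub>t_ring\<^esub> P_hat A v0 N) (m_hat v0 N)"
  shows "Phi m b ` colon_ideal t_ring (Q_hat A v0 N) (m_hat v0 N) =
         colon_ideal (s_ring m) (P_intr A v0 m b N) (m_intr v0 m b N)"
proof -
  let ?Phi = "Phi m b"
  interpret Phi: ring_hom_ring "t_ring :: ('n, complex) mps ring" "s_ring m" ?Phi by (rule Phi_hom)
  have add: "?Phi (f + g) = ?Phi f + ?Phi g" and mult: "?Phi (f * g) = ?Phi f * ?Phi g" for f g
    using Phi.hom_add [of f g] Phi.hom_mult [of f g] by simp_all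
  have diff: "?Phi (f - g) = ?Phi f - ?Phi g" for f g
    using add [of "f - g" g] by simp
  note kb = \<open>kernel_basis A m b\<close>
  note surj = Phi_surj_kernel(1) [OF kb] and ker = Phi_surj_kernel(2) [OF kb]
  note P = Phi_P_hat [OF kb, of v0 N]
  have m_hat: "?Phi (m_hat v0 N) = m_intr v0 m b N"
    by (simp add: m_hat_def m_intr_def Phi_t_monom)
  \<comment> \<open>Since \<open>nsupp v0 0\<close> belongs to \<open>N\<close>, the monomial
    \<open>m_hat\<close> is one of the generators of \<open>M_hat\<close>.\<close>
  have m_hat_M: "m_hat v0 N \<in> M_hat N"
    using assms(7) by (auto simp: m_hat_def neg_supp_family_def intro: t_monom_in_M_hat)
  show ?thesis
  proof (intro equalityI subsetI)
    fix h assume "h \<in> ?Phi ` colon_ideal t_ring (Q_hat A v0 N) (m_hat v0 N)"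
    then obtain f where h: "h = ?Phi f" and f: "f * m_hat v0 N \<in> Q_hat A v0 N"
      by (auto simp: colon_ideal_def)
    from f obtain q p where q: "q \<in> At_ideal A \<cdot>\<^bsub>t_ring\<^esub> M_hat N" and p: "p \<in> P_hat A v0 N"
      and eq: "f * m_hat v0 N = q + p"
      by (auto simp: Q_hat_def set_add_def')
    \<comment> \<open>A product of ideals lies in their intersection, so \<Phi> kills
      \<open>q\<close> and only the \<open>P_hat\<close> part survives.\<close>
    have "q \<in> At_ideal A"
      using q ring.ideal_prod_inter [OF cring.axioms(1) [OF mps_ring_cring] At_ideal_is_ideal M_hat_is_ideal] by blast
    then have "?Phi q = 0" by (rule At_ideal_subset_kernel [OF kb])
    then have "h * m_intr v0 m b N = ?Phi p"
      by (simp add: h add flip: m_hat mult eq) (simp add: eq add)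
    also have "\<dots> \<in> P_intr A v0 m b N" using p P by blast
    finally show "h \<in> colon_ideal (s_ring m) (P_intr A v0 m b N) (m_intr v0 m b N)"
      using surj by (auto simp: colon_ideal_def h)
  next
    fix h assume "h \<in> colon_ideal (s_ring m) (P_intr A v0 m b N) (m_intr v0 m b N)"
    then have h: "h \<in> carrier (s_ring m)" "h * m_intr v0 m b N \<in> P_intr A v0 m b N"
      by (auto simp: colon_ideal_def)
    from h(1) obtain f where f: "h = ?Phi f" using surj by blast
    from h(2) obtain p where p: "p \<in> P_hat A v0 N" "h * m_intr v0 m b N = ?Phi p" using P by blast
    \<comment> \<open>Both \<open>f\<close> and \<open>p\<close> are preimages under \<Phi>, so this
      difference measures how far the membership fails to lift; it will be absorbed by the
      intersection term.\<close>
    let ?d = "f * m_hat v0 N - p"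
    have "?Phi ?d = 0" using p(2) by (simp add: diff mult m_hat f)
    then have "?d \<in> At_ideal A" by (rule ker)
    \<comment> \<open>Both terms of the difference lie in \<open>M_hat\<close>: the first as a
      multiple of \<open>m_hat\<close>, the second through \<open>P_hat\<close>.\<close>
    moreover have "?d \<in> M_hat N"
      using p(1) P_hat_subset_M_hat m_hat_M by (intro t_ideal_closed [OF M_hat_is_ideal]) auto
    ultimately have "?d + p \<in> (At_ideal A \<inter> M_hat N) <+>\<^bsub>t_ring\<^esub> P_hat A v0 N"
      using p(1) unfolding set_add_def' mps_ring_simps by blast
    then have "f \<in> colon_ideal t_ring ((At_ideal A \<inter> M_hat N) <+>\<^bsub>t_ring\<^esub> P_hat A v0 N) (m_hat v0 N)"
      by (simp add: colon_ideal_def)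
    \<comment> \<open>The assumed equality of colon ideals replaces the intersection by the
      product.\<close>
    then have "f \<in> colon_ideal t_ring (Q_hat A v0 N) (m_hat v0 N)"
      using assms(9) by (simp add: Q_hat_def)
    then show "h \<in> ?Phi ` colon_ideal t_ring (Q_hat A v0 N) (m_hat v0 N)"
      unfolding f by (rule imageI)
  qed
qed

end
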